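(* Consider the multiobjective problem $\min_{x\in\mathcal{M}}F(x)=(f_1(x),\dots,f_m(x))^T$, where $f_1,\dots,f_m:\mathcal{M}\to\mathbb{R}$ are locally Lipschitz, and assume that at least one of the objective functions $f_i$ is bounded below. Let $\varepsilon\in(0,\frac12\iota(\mathcal{M}))$, $\delta>0$, $c\in(0,1)$, $\alpha>1$, $t_0>0$, $x_0\in\mathcal{M}$, and let $\{x_k\}$ be the sequence generated by Algorithm 1 (described in the context). Then $\{x_k\}$ is finite, and its last element $x_*$ is $(\varepsilon,\delta)$-critical, i.e. $$\min_{g\in-G_\varepsilon(x_* )}\|g\|\le\delta .$$
   Context: $\mathcal{M}$ is a complete $d$-dimensional ($d\ge 1$) smooth Riemannian manifold with metric $\langle\cdot,\cdot\rangle$, induced norm $\|\cdot\|$ on tangent spaces, and Riemannian distance $\mathrm{dist}$. $\operatorname{cl}$, $\operatorname{conv}$ denote closure and convex hull; $0_x$ is the zero of $T_x\mathcal{M}$. Retraction: $R:T\mathcal{M}\to\mathcal{M}$ is a fixed smooth map such that, with $R_x=R|_{T_x\mathcal{M}}$, $R_x(0_x)=x$ and $\mathrm{D}R_x(0_x)=\mathrm{id}_{T_x\mathcal{M}}$; moreover there is a constant $\kappa$ with $\mathrm{dist}(R_x(\xi),x)\le\kappa\|\xi\|$ for all $x\in\mathcal{M}$, $\xi\in T_x\mathcal{M}$. Write $B(0_x,r)=\{\xi\in T_x\mathcal{M}:\|\xi\|<r\}$, $B_R(x,r)=R_x(B(0_x,r))$, $\iota(x)=\sup\{r>0: R_x:B(0_x,r)\to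 B_R(x,r)\text{ is injective}\}$, $\iota(\mathcal{M})=\inf_{x\in\mathcal{M}}\iota(x)$; it is assumed that $\iota(\mathcal{M})>0$. Vector transport: $\mathcal{T}:T\mathcal{M}\oplus T\mathcal{M}\to T\mathcal{M}$, $(\eta_x,\xi_x)\mapsto\mathcal{T}_{\eta_x}(\xi_x)$, is a fixed smooth map such that $\mathcal{T}_{\eta_x}:T_x\mathcal{M}\to T_{R_x(\eta_x)}\mathcal{M}$ is linear and $\mathcal{T}_{0_x}(\xi_x)=\xi_x$. It is assumed isometric, $\langle\mathcal{T}_{\eta_x}(\xi_x),\mathcal{T}_{\eta_x}(\zeta_x)\rangle=\langle\xi_x,\zeta_x\rangle$, and to satisfy the locking condition $\mathcal{T}_{\xi_x}(\xi_x)=\beta_{\xi_x}\,\mathrm{D}R_x(\xi_x)[\xi_x]$ with $\beta_{\xi_x}=\|\xi_x\|/\|\mathrm{D}R_x(\xi_x)[\xi_x]\|$ for $\xi_x\ne0_x$; convention $\beta_{0_x}=1$. For $y=R_x(\eta)$ with $\|\eta\|<\iota(x)$, $\mathcal{T}_{x\leftarrow y}:=(\mathcal{T}_\eta)^{-1}:T_y\mathcal{M}\to T_x\mathcal{M}$. Locally Lipschitz: every point has a neighborhood on which $|f(z)-f(y)|\le L\,\mathrm{dist}(z,y)$ for some $L>0$. Riemannian subdifferential: $\partial f(x)=\partial(f\circ R_x)(0_x)\subset T_x\mathcal{M}$, where the right side is the Clarke subdifferential on the Hilbert space $T_x\mathcal{M}$ ($\partial\phi(x)=\{\xi:\langle\xi,v\rangle\le\phi^\circ(x;v)\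 \forall v\}$, $\phi^\circ(x;v)=\limsup_{y\to x,\,t\downarrow0}\frac{\phi(y+tv)-\phi(y)}{t}$). For $\varepsilon\in(0,\frac12\iota(x))$ the Riemannian $\varepsilon$-subdifferential is $\partial_\varepsilon f(x)=\operatorname{cl\,conv}\{\beta_\eta^{-1}\mathcal{T}_{x\leftarrow y}(\partial f(y)): y\in\operatorname{cl}B_R(x,\varepsilon),\ \eta=R_x^{-1}(y)\}$ (with $\eta$ the unique preimage of norm $<\iota(x)$), and $G_\varepsilon(x)=\operatorname{conv}\big(\bigcup_{i=1}^m\partial_\varepsilon f_i(x)\big)$. Procedure $\mathcal{P}_{\rm ns}(j,x_k,\tilde g,\varepsilon,c)$ (for $\tilde g\ne 0$): let $h_j(t)=f_j(R_{x_k}(t\tilde g))-f_j(x_k)+ct\|\tilde g\|^2$. (0) Set $a=0$, $b=\varepsilon/\|\tilde g\|$, $t=\frac{a+b}2$. (1) Compute some $\tilde\xi^j\in\partial f_j(R_{x_k}(t\tilde g))$. (2) If $\langle\beta_{t\tilde g}^{-1}\mathcal{T}_{x_k\leftarrow R_{x_k}(t\tilde g)}\tilde\xi^j,\tilde g\rangle>-c\|\tilde g\|^2$, stop and return $(t,\tilde\xi^j)$. (3) If $h_j(b)>h_j(t)$ set $a=t$, else set $b=t$. (4) Set $t=\frac{a+b}2$ and go to (1). Procedure $\mathcal{P}_{\rm dd}(x_k,\varepsilon,\delta,c)$: (0) Compute some $\xi^i\in\partial_\varepsilon f_i(x_k)$ for each $i=1,\dots,m$; set $W_0=\{\xi^1,\dots,\xi^m\}$,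 $s=0$. (1) $\tilde g_s=\operatorname{argmin}_{g\in-\operatorname{conv}W_s}\|g\|$. (2) If $\|\tilde g_s\|\le\delta$, return $g_k=\tilde g_s$ and stop. (3) Let $I_s=\{j\in\{1,\dots,m\}: f_j(R_{x_k}(\frac{\varepsilon}{\|\tilde g_s\|}\tilde g_s))>f_j(x_k)-c\varepsilon\|\tilde g_s\|\}$; if $I_s=\emptyset$, return $g_k=\tilde g_s$ and stop. (4) For each $j\in I_s$ let $(t,\tilde\xi_s^j)=\mathcal{P}_{\rm ns}(j,x_k,\tilde g_s,\varepsilon,c)$ and $\xi_s^j=\beta_{t\tilde g_s}^{-1}\mathcal{T}_{x_k\leftarrow R_{x_k}(t\tilde g_s)}\tilde\xi_s^j$. (5) Set $W_{s+1}=W_s\cup\{\xi_s^j:j\in I_s\}$, increase $s$ by one, go to (1). Algorithm 1: (0) Start with $x_0$, $k=0$. (1) $g_k=\mathcal{P}_{\rm dd}(x_k,\varepsilon,\delta,c)$. (2) If $\|g_k\|\le\delta$, stop. (3) Find the smallest integer $\ell\in\{0,1,\dots,[\frac{\ln(t_0\|g_k\|)-\ln\varepsilon}{\ln\alpha}]\}$ ($[\cdot]$ is the largest integer not exceeding the argument; the set is empty if this number is negative) with $f_i(R_{x_k}(\alpha^{-\ell}t_0g_k))\le f_i(x_k)-\alpha^{-\ell}t_0c\|g_k\|^2$ for all $i\in\{1,\dots,m\}$. If such $\ell$ exists set $t_k=\alpha^{-\ell}t_0$, otherwise $t_k=\varepsilon/\|g_k\|$. (4) $x_{k+1}=R_{x_k}(t_kg_k)$,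 increase $k$ by one, go to (1).
   Formalization: Only runs in which every call of the procedure P_ns returns are considered; P_ns can loop forever for locally Lipschitz objectives, and then the last iterate need not be (ε,δ)-critical. Termination of P_dd and of Algorithm 1 is proved. *)

theory Defs
  imports "HOL-Analysis.Analysis"
begin

section \<open>Smooth maps between Euclidean spaces\<close>

text \<open>Only used for open sets \<open>S\<close>. In finite dimension, iterated differentiability of all
  directional derivatives is the usual notion of a \<open>C\<^sup>k\<close> map.\<close>

primrec Ck_on :: "nat \<Rightarrow> 'b::euclidean_space set \<Rightarrow> ('b \<Rightarrow> 'c::real_normed_vector) \<Rightarrow> bool" where
  "Ck_on 0 S f \<longleftrightarrow> continuous_on S f"
| "Ck_on (Suc k) S f \<longleftrightarrow>
     (\<forall>x\<in>S. f differentiable (at x)) \<and> (\<forall>v. Ck_on k S (\<lambda>x. frechet_derivative f (at x) v))"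

definition smooth_on :: "'b::euclidean_space set \<Rightarrow> ('b \<Rightarrow> 'c::real_normed_vector) \<Rightarrow> bool" where
  "smooth_on S f \<longleftrightarrow> (\<forall>k. Ck_on k S f)"


section \<open>Manifolds, tangent vectors, Riemannian metrics\<close>

text \<open>A chart is a pair \<open>(U, \<phi>)\<close>; only the values of \<open>\<phi>\<close> on \<open>U\<close> matter. The points of the
  manifold are all elements of the type \<open>'a\<close>, which carries the manifold topology, and the
  model space \<open>'e\<close> has dimension \<open>d = DIM('e) \<ge> 1\<close>.

  The tangent space at \<open>x\<close> is the vector space \<open>'e\<close>: a tangent vector is given by its components
  in one chart \<open>chart_at M x\<close> around \<open>x\<close>, chosen once and for all from the atlas. The choice
  does not depend continuously on \<open>x\<close>, so smoothness of anything involving tangent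
  vectors is always expressed in the bundle charts induced by the charts of the atlas.\<close>

type_synonym ('a, 'e) chart = "'a set \<times> ('a \<Rightarrow> 'e)"

record ('a, 'e) rmanifold =
  atlas :: "('a, 'e) chart set"
  metric :: "'a \<Rightarrow> 'e \<Rightarrow> 'e \<Rightarrow> real"
  retr :: "'a \<Rightarrow> 'e \<Rightarrow> 'a"
  transp :: "'a \<Rightarrow> 'e \<Rightarrow> 'e \<Rightarrow> 'e"

definition chart_inv :: "('a, 'e) chart \<Rightarrow> 'e \<Rightarrow> 'a" where
  "chart_inv c = inv_into (fst c) (snd c)"

definition chart_at :: "('a, 'e, 'z) rmanifold_scheme \<Rightarrow> 'a \<Rightarrow> ('a, 'e) chart" where
  "chart_at M x = (SOME c. c \<in> atlas M \<and> x \<in> fst c)"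

locale smooth_manifold =
  fixes M :: "('a::{t2_space,second_countable_topology}, 'e::euclidean_space) rmanifold"
  assumes open_domain: "c \<in> atlas M \<Longrightarrow> open (fst c)"
    and open_range: "c \<in> atlas M \<Longrightarrow> open (snd c ` fst c)"
    and chart_homeomorphism: "c \<in> atlas M \<Longrightarrow> homeomorphism (fst c) (snd c ` fst c) (snd c) (chart_inv c)"
    and charts_cover: "\<exists>c\<in>atlas M. x \<in> fst c"
    and charts_compatible: "\<lbrakk>c \<in> atlas M; c' \<in> atlas M\<rbrakk>
      \<Longrightarrow> smooth_on (snd c ` (fst c \<inter> fst c')) (snd c' \<circ> chart_inv c)"

text \<open>Change of components of a tangent vector at \<open>x\<close> from chart \<open>c\<close> to chart \<open>c'\<close>.\<close>

definition chart_change ::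
    "('a, 'e::euclidean_space) chart \<Rightarrow> ('a, 'e) chart \<Rightarrow> 'a \<Rightarrow> 'e \<Rightarrow> 'e" where
  "chart_change c c' x = frechet_derivative (snd c' \<circ> chart_inv c) (at (snd c x))"

text \<open>The tangent vector at \<open>x\<close> with components \<open>u\<close> in chart \<open>c\<close>, and the converse.\<close>

definition from_chart ::
    "('a, 'e::euclidean_space, 'z) rmanifold_scheme \<Rightarrow> ('a, 'e) chart \<Rightarrow> 'a \<Rightarrow> 'e \<Rightarrow> 'e" where
  "from_chart M c x = chart_change c (chart_at M x) x"

definition to_chart ::
    "('a, 'e::euclidean_space, 'z) rmanifold_scheme \<Rightarrow> ('a, 'e) chart \<Rightarrow> 'a \<Rightarrow> 'e \<Rightarrow> 'e" where
  "to_chart M c x = chart_change (chart_at M x) c x"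

locale riemannian_manifold = smooth_manifold +
  assumes metric_bilinear: "bilinear (metric M x)"
    and metric_sym: "metric M x u v = metric M x v u"
    and metric_pos: "v \<noteq> 0 \<Longrightarrow> metric M x v v > 0"
    and metric_smooth: "c \<in> atlas M \<Longrightarrow>
      smooth_on (snd c ` fst c)
        (\<lambda>p. metric M (chart_inv c p) (from_chart M c (chart_inv c p) u) (from_chart M c (chart_inv c p) v))"

definition tnorm :: "('a, 'e, 'z) rmanifold_scheme \<Rightarrow> 'a \<Rightarrow> 'e \<Rightarrow> real" where
  "tnorm M x v = sqrt (metric M x v v)"


section \<open>Riemannian distance and completeness\<close>

definition pw_C1_curve ::
    "('a::topological_space, 'e::euclidean_space, 'z) rmanifold_scheme \<Rightarrow> (real \<Rightarrow> 'a) \<Rightarrow> bool" where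
  "pw_C1_curve M \<gamma> \<longleftrightarrow> continuous_on {0..1} \<gamma> \<and>
     (\<forall>c\<in>atlas M. \<forall>a b. {a..b} \<subseteq> {0..1} \<and> \<gamma> ` {a..b} \<subseteq> fst c
        \<longrightarrow> (snd c \<circ> \<gamma>) piecewise_C1_differentiable_on {a..b})"

text \<open>The library notion \<open>piecewise_C1_differentiable_on\<close> allows unbounded velocity near the
  finitely many break points; hence the length is a nonnegative Lebesgue integral, possibly
  infinite. This does not affect the infimum of the lengths.\<close>

definition curve_length ::
    "('a::topological_space, 'e::euclidean_space, 'z) rmanifold_scheme \<Rightarrow> (real \<Rightarrow> 'a) \<Rightarrow> ennreal" where
  "curve_length M \<gamma> =
     (\<integral>\<^sup>+t\<in>{0..1}. ennreal (tnorm M (\<gamma> t) (vector_derivative (snd (chart_at M (\<gamma> t)) \<circ> \<gamma>) (at t))) \<partial>lborel)"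

text \<open>Points in different connected components have distance \<open>\<infinity>\<close>, so connectedness
  need not be assumed.\<close>

definition rdist ::
    "('a::topological_space, 'e::euclidean_space, 'z) rmanifold_scheme \<Rightarrow> 'a \<Rightarrow> 'a \<Rightarrow> ennreal" where
  "rdist M x y = Inf {curve_length M \<gamma> |\<gamma>. pw_C1_curve M \<gamma> \<and> \<gamma> 0 = x \<and> \<gamma> 1 = y}"

locale complete_riemannian_manifold = riemannian_manifold +
  assumes complete: "(\<And>e. e > 0 \<Longrightarrow> \<exists>N. \<forall>m\<ge>N. \<forall>n\<ge>N. rdist M (X m) (X n) < e)
    \<Longrightarrow> \<exists>l. (\<lambda>n::nat. rdist M (X n) l) \<longlonglongrightarrow> 0"


section \<open>Retraction\<close>

text \<open>Smoothness of the retraction, as a map from the tangent bundle, in the bundle chart of \<open>c\<close>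
  and the chart \<open>c'\<close>. Openness of the domain for all \<open>c'\<close> expresses continuity.\<close>

definition retr_dom ::
    "('a, 'e::euclidean_space, 'z) rmanifold_scheme \<Rightarrow> ('a, 'e) chart \<Rightarrow> ('a, 'e) chart \<Rightarrow> ('e \<times> 'e) set" where
  "retr_dom M c c' = {(p, u). p \<in> snd c ` fst c \<and>
     retr M (chart_inv c p) (from_chart M c (chart_inv c p) u) \<in> fst c'}"

definition retr_smooth :: "('a, 'e::euclidean_space, 'z) rmanifold_scheme \<Rightarrow> bool" where
  "retr_smooth M \<longleftrightarrow> (\<forall>c\<in>atlas M. \<forall>c'\<in>atlas M. open (retr_dom M c c') \<and>
     smooth_on (retr_dom M c c')
       (\<lambda>(p, u). snd c' (retr M (chart_inv c p) (from_chart M c (chart_inv c p) u))))"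

text \<open>\<open>dretr M x \<xi> \<zeta> = DR\<^sub>x(\<xi>)[\<zeta>]\<close>, a tangent vector at \<open>R\<^sub>x(\<xi>)\<close>.\<close>

definition dretr ::
    "('a, 'e::euclidean_space, 'z) rmanifold_scheme \<Rightarrow> 'a \<Rightarrow> 'e \<Rightarrow> 'e \<Rightarrow> 'e" where
  "dretr M x \<xi> = frechet_derivative (\<lambda>\<eta>. snd (chart_at M (retr M x \<xi>)) (retr M x \<eta>)) (at \<xi>)"

definition tball :: "('a, 'e, 'z) rmanifold_scheme \<Rightarrow> 'a \<Rightarrow> real \<Rightarrow> 'e set" where
  "tball M x r = {\<xi>. tnorm M x \<xi> < r}"

definition ball_R :: "('a, 'e, 'z) rmanifold_scheme \<Rightarrow> 'a \<Rightarrow> real \<Rightarrow> 'a set" where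
  "ball_R M x r = retr M x ` tball M x r"

definition inj_radius_at :: "('a, 'e, 'z) rmanifold_scheme \<Rightarrow> 'a \<Rightarrow> ereal" where
  "inj_radius_at M x = Sup (ereal ` {r. r > 0 \<and> inj_on (retr M x) (tball M x r)})"

definition inj_radius :: "('a, 'e, 'z) rmanifold_scheme \<Rightarrow> ereal" where
  "inj_radius M = (INF x. inj_radius_at M x)"

locale retraction_manifold = complete_riemannian_manifold +
  assumes retr_smooth: "retr_smooth M"
    and retr_zero: "retr M x 0 = x"
    and dretr_zero: "dretr M x 0 = id"
    and retr_dist: "\<exists>\<kappa>. \<forall>x \<xi>. rdist M (retr M x \<xi>) x \<le> ennreal (\<kappa> * tnorm M x \<xi>)"
    and inj_radius_pos: "inj_radius M > 0"

definition retr_inv :: "('a, 'e, 'z) rmanifold_scheme \<Rightarrow> 'a \<Rightarrow> 'a \<Rightarrow> 'e" where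
  "retr_inv M x y = (THE \<eta>. ereal (tnorm M x \<eta>) < inj_radius_at M x \<and> retr M x \<eta> = y)"


section \<open>Vector transport\<close>

definition transp_smooth :: "('a, 'e::euclidean_space, 'z) rmanifold_scheme \<Rightarrow> bool" where
  "transp_smooth M \<longleftrightarrow> (\<forall>c\<in>atlas M. \<forall>c'\<in>atlas M.
     smooth_on {(p, u, w). (p, u) \<in> retr_dom M c c'}
       (\<lambda>(p, u, w). let x = chart_inv c p; \<eta> = from_chart M c x u; \<zeta> = from_chart M c x w
          in to_chart M c' (retr M x \<eta>) (transp M x \<eta> \<zeta>)))"

definition beta :: "('a, 'e::euclidean_space, 'z) rmanifold_scheme \<Rightarrow> 'a \<Rightarrow> 'e \<Rightarrow> real" where
  "beta M x \<xi> = (if \<xi> = 0 then 1 else tnorm M x \<xi> / tnorm M (retr M x \<xi>) (dretr M x \<xi> \<xi>))"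

locale transport_manifold = retraction_manifold +
  assumes transp_smooth: "transp_smooth M"
    and transp_linear: "linear (transp M x \<eta>)"
    and transp_zero: "transp M x 0 \<xi> = \<xi>"
    and transp_isometric: "metric M (retr M x \<eta>) (transp M x \<eta> \<xi>) (transp M x \<eta> \<zeta>) = metric M x \<xi> \<zeta>"
    and locking: "\<xi> \<noteq> 0 \<Longrightarrow> transp M x \<xi> \<xi> = beta M x \<xi> *\<^sub>R dretr M x \<xi> \<xi>"

text \<open>Maps the tangent space at \<open>y\<close> to the one at \<open>x\<close>; \<open>inv\<close> is a true inverse, since an isometric, hence injective,
  linear endomorphism of \<open>'e\<close> is bijective.\<close>

definition transp_back :: "('a, 'e, 'z) rmanifold_scheme \<Rightarrow> 'a \<Rightarrow> 'a \<Rightarrow> 'e \<Rightarrow> 'e" where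
  "transp_back M x y = inv (transp M x (retr_inv M x y))"


section \<open>Subdifferentials\<close>

definition locally_lipschitz ::
    "('a::topological_space, 'e::euclidean_space, 'z) rmanifold_scheme \<Rightarrow> ('a \<Rightarrow> real) \<Rightarrow> bool" where
  "locally_lipschitz M f \<longleftrightarrow>
     (\<forall>x. \<exists>U L. open U \<and> x \<in> U \<and> L > 0 \<and>
        (\<forall>y\<in>U. \<forall>z\<in>U. ennreal \<bar>f z - f y\<bar> \<le> ennreal L * rdist M z y))"

definition clarke_derivative :: "('e::real_normed_vector \<Rightarrow> real) \<Rightarrow> 'e \<Rightarrow> 'e \<Rightarrow> ereal" where
  "clarke_derivative \<phi> x v =
     Limsup (nhds x \<times>\<^sub>F at_right 0) (\<lambda>(y, t::real). ereal ((\<phi> (y + t *\<^sub>R v) - \<phi> y) / t))"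

text \<open>The Hilbert space structure of a tangent space is the metric at that point and not the inner
  product of the type \<open>'e\<close>; hence the parameter \<open>ip\<close>. Both induce the same topology.\<close>

definition clarke_subdiff ::
    "('e::real_normed_vector \<Rightarrow> 'e \<Rightarrow> real) \<Rightarrow> ('e \<Rightarrow> real) \<Rightarrow> 'e \<Rightarrow> 'e set" where
  "clarke_subdiff ip \<phi> x = {\<xi>. \<forall>v. ereal (ip \<xi> v) \<le> clarke_derivative \<phi> x v}"

definition subdiff ::
    "('a, 'e::euclidean_space, 'z) rmanifold_scheme \<Rightarrow> ('a \<Rightarrow> real) \<Rightarrow> 'a \<Rightarrow> 'e set" where
  "subdiff M f x = clarke_subdiff (metric M x) (f \<circ> retr M x) 0"

definition eps_subdiff ::
    "('a::topological_space, 'e::euclidean_space, 'z) rmanifold_scheme \<Rightarrow> real \<Rightarrow> ('a \<Rightarrow> real) \<Rightarrow> 'a \<Rightarrow> 'e set" where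
  "eps_subdiff M \<epsilon> f x = closure (convex hull
     (\<Union>y\<in>closure (ball_R M x \<epsilon>).
        (\<lambda>\<xi>. inverse (beta M x (retr_inv M x y)) *\<^sub>R transp_back M x y \<xi>) ` subdiff M f y))"

text \<open>The objectives are \<open>f 1, \<dots>, f m\<close>.\<close>

definition G_eps ::
    "('a::topological_space, 'e::euclidean_space, 'z) rmanifold_scheme \<Rightarrow> (nat \<Rightarrow> 'a \<Rightarrow> real) \<Rightarrow> nat \<Rightarrow> real \<Rightarrow> 'a \<Rightarrow> 'e set" where
  "G_eps M f m \<epsilon> x = convex hull (\<Union>i\<in>{1..m}. eps_subdiff M \<epsilon> (f i) x)"

text \<open>The minimum of the norm over \<open>- G_eps\<close> is attained and is at most \<open>\<delta>\<close>.\<close>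

definition eps_delta_critical ::
    "('a::topological_space, 'e::euclidean_space, 'z) rmanifold_scheme \<Rightarrow> (nat \<Rightarrow> 'a \<Rightarrow> real) \<Rightarrow> nat \<Rightarrow> real \<Rightarrow> real \<Rightarrow> 'a \<Rightarrow> bool" where
  "eps_delta_critical M f m \<epsilon> \<delta> x \<longleftrightarrow>
     (\<exists>g. is_arg_min (tnorm M x) (\<lambda>g. g \<in> uminus ` G_eps M f m \<epsilon> x) g \<and> tnorm M x g \<le> \<delta>)"


section \<open>The bisection procedure\<close>

text \<open>All procedures are nondeterministic, since they compute \<^emph>\<open>some\<close> subgradient; they are
  modelled by the relation between inputs and possible return values.\<close>

definition ns_h ::
    "('a, 'e::real_vector, 'z) rmanifold_scheme \<Rightarrow> ('a \<Rightarrow> real) \<Rightarrow> 'a \<Rightarrow> 'e \<Rightarrow> real \<Rightarrow> real \<Rightarrow> real" where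
  "ns_h M \<phi> x g c t = \<phi> (retr M x (t *\<^sub>R g)) - \<phi> x + c * t * (tnorm M x g)\<^sup>2"

definition ns_pull :: "('a, 'e::euclidean_space, 'z) rmanifold_scheme \<Rightarrow> 'a \<Rightarrow> 'e \<Rightarrow> real \<Rightarrow> 'e \<Rightarrow> 'e" where
  "ns_pull M x g t \<xi> = inverse (beta M x (t *\<^sub>R g)) *\<^sub>R transp_back M x (retr M x (t *\<^sub>R g)) \<xi>"

text \<open>\<open>ns_loop M \<phi> x g c a b t \<xi>\<close>: started with the bracket \<open>a\<close>, \<open>b\<close>, the bisection loop can stop
  after finitely many rounds and return \<open>(t, \<xi>)\<close>.\<close>

inductive ns_loop ::
    "('a, 'e::euclidean_space, 'z) rmanifold_scheme \<Rightarrow> ('a \<Rightarrow> real) \<Rightarrow> 'a \<Rightarrow> 'e \<Rightarrow> real \<Rightarrow> real \<Rightarrow> real \<Rightarrow> real \<Rightarrow> 'e \<Rightarrow> bool"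
  for M \<phi> x g c where
  stop: "\<lbrakk>t = (a + b) / 2; \<xi> \<in> subdiff M \<phi> (retr M x (t *\<^sub>R g));
      metric M x (ns_pull M x g t \<xi>) g > - c * (tnorm M x g)\<^sup>2\<rbrakk>
    \<Longrightarrow> ns_loop M \<phi> x g c a b t \<xi>"
| left: "\<lbrakk>s = (a + b) / 2; \<zeta> \<in> subdiff M \<phi> (retr M x (s *\<^sub>R g));
      \<not> metric M x (ns_pull M x g s \<zeta>) g > - c * (tnorm M x g)\<^sup>2;
      ns_h M \<phi> x g c b > ns_h M \<phi> x g c s; ns_loop M \<phi> x g c s b t \<xi>\<rbrakk>
    \<Longrightarrow> ns_loop M \<phi> x g c a b t \<xi>"
| right: "\<lbrakk>s = (a + b) / 2; \<zeta> \<in> subdiff M \<phi> (retr M x (s *\<^sub>R g));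
      \<not> metric M x (ns_pull M x g s \<zeta>) g > - c * (tnorm M x g)\<^sup>2;
      \<not> ns_h M \<phi> x g c b > ns_h M \<phi> x g c s; ns_loop M \<phi> x g c a s t \<xi>\<rbrakk>
    \<Longrightarrow> ns_loop M \<phi> x g c a b t \<xi>"

definition ns_returns ::
    "('a, 'e::euclidean_space, 'z) rmanifold_scheme \<Rightarrow> ('a \<Rightarrow> real) \<Rightarrow> 'a \<Rightarrow> 'e \<Rightarrow> real \<Rightarrow> real \<Rightarrow> real \<Rightarrow> 'e \<Rightarrow> bool" where
  "ns_returns M \<phi> x g \<epsilon> c t \<xi> \<longleftrightarrow> ns_loop M \<phi> x g c 0 (\<epsilon> / tnorm M x g) t \<xi>"


section \<open>The descent direction procedure\<close>

definition dd_init ::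
    "('a::topological_space, 'e::euclidean_space, 'z) rmanifold_scheme \<Rightarrow> (nat \<Rightarrow> 'a \<Rightarrow> real) \<Rightarrow> nat \<Rightarrow> real \<Rightarrow> 'a \<Rightarrow> 'e set \<Rightarrow> bool" where
  "dd_init M f m \<epsilon> x W \<longleftrightarrow>
     (\<exists>\<Xi>. (\<forall>i\<in>{1..m}. \<Xi> i \<in> eps_subdiff M \<epsilon> (f i) x) \<and> W = \<Xi> ` {1..m})"

definition dd_direction :: "('a, 'e::real_vector, 'z) rmanifold_scheme \<Rightarrow> 'a \<Rightarrow> 'e set \<Rightarrow> 'e \<Rightarrow> bool" where
  "dd_direction M x W g \<longleftrightarrow> is_arg_min (tnorm M x) (\<lambda>g. g \<in> uminus ` (convex hull W)) g"

definition dd_bad ::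
    "('a, 'e::real_vector, 'z) rmanifold_scheme \<Rightarrow> (nat \<Rightarrow> 'a \<Rightarrow> real) \<Rightarrow> nat \<Rightarrow> real \<Rightarrow> real \<Rightarrow> 'a \<Rightarrow> 'e \<Rightarrow> nat set" where
  "dd_bad M f m \<epsilon> c x g = {j\<in>{1..m}.
     f j (retr M x ((\<epsilon> / tnorm M x g) *\<^sub>R g)) > f j x - c * \<epsilon> * tnorm M x g}"

text \<open>One full round, from \<open>W\<^sub>s\<close> to \<open>W\<^sub>s\<^sub>+\<^sub>1\<close>; it requires each bisection call in the round to
  return.\<close>

definition dd_step ::
    "('a::topological_space, 'e::euclidean_space, 'z) rmanifold_scheme \<Rightarrow> (nat \<Rightarrow> 'a \<Rightarrow> real) \<Rightarrow> nat \<Rightarrow> real \<Rightarrow> real \<Rightarrow> real \<Rightarrow> 'a \<Rightarrow> 'e set \<Rightarrow> 'e set \<Rightarrow> bool" where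
  "dd_step M f m \<epsilon> \<delta> c x W W' \<longleftrightarrow>
     (\<exists>g \<Xi>. dd_direction M x W g \<and> \<not> tnorm M x g \<le> \<delta> \<and> dd_bad M f m \<epsilon> c x g \<noteq> {} \<and>
        (\<forall>j\<in>dd_bad M f m \<epsilon> c x g. \<exists>t \<xi>. ns_returns M (f j) x g \<epsilon> c t \<xi> \<and> \<Xi> j = ns_pull M x g t \<xi>) \<and>
        W' = W \<union> \<Xi> ` dd_bad M f m \<epsilon> c x g)"

definition dd_returns ::
    "('a::topological_space, 'e::euclidean_space, 'z) rmanifold_scheme \<Rightarrow> (nat \<Rightarrow> 'a \<Rightarrow> real) \<Rightarrow> nat \<Rightarrow> real \<Rightarrow> real \<Rightarrow> real \<Rightarrow> 'a \<Rightarrow> 'e \<Rightarrow> bool" where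
  "dd_returns M f m \<epsilon> \<delta> c x g \<longleftrightarrow>
     (\<exists>W\<^sub>0 W. dd_init M f m \<epsilon> x W\<^sub>0 \<and> (dd_step M f m \<epsilon> \<delta> c x)\<^sup>*\<^sup>* W\<^sub>0 W \<and>
        dd_direction M x W g \<and> (tnorm M x g \<le> \<delta> \<or> dd_bad M f m \<epsilon> c x g = {}))"

definition dd_diverges ::
    "('a::topological_space, 'e::euclidean_space, 'z) rmanifold_scheme \<Rightarrow> (nat \<Rightarrow> 'a \<Rightarrow> real) \<Rightarrow> nat \<Rightarrow> real \<Rightarrow> real \<Rightarrow> real \<Rightarrow> 'a \<Rightarrow> bool" where
  "dd_diverges M f m \<epsilon> \<delta> c x \<longleftrightarrow>
     (\<exists>W. dd_init M f m \<epsilon> x (W 0) \<and> (\<forall>s. dd_step M f m \<epsilon> \<delta> c x (W s) (W (Suc s))))"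


section \<open>The descent method\<close>

definition armijo ::
    "('a, 'e::real_vector, 'z) rmanifold_scheme \<Rightarrow> (nat \<Rightarrow> 'a \<Rightarrow> real) \<Rightarrow> nat \<Rightarrow> real \<Rightarrow> real \<Rightarrow> real \<Rightarrow> real \<Rightarrow> 'a \<Rightarrow> 'e \<Rightarrow> nat \<Rightarrow> bool" where
  "armijo M f m \<epsilon> c \<alpha> t\<^sub>0 x g l \<longleftrightarrow>
     int l \<le> \<lfloor>(ln (t\<^sub>0 * tnorm M x g) - ln \<epsilon>) / ln \<alpha>\<rfloor> \<and>
     (\<forall>i\<in>{1..m}. f i (retr M x ((t\<^sub>0 / \<alpha> ^ l) *\<^sub>R g)) \<le> f i x - t\<^sub>0 / \<alpha> ^ l * c * (tnorm M x g)\<^sup>2)"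

definition step_size ::
    "('a, 'e::real_vector, 'z) rmanifold_scheme \<Rightarrow> (nat \<Rightarrow> 'a \<Rightarrow> real) \<Rightarrow> nat \<Rightarrow> real \<Rightarrow> real \<Rightarrow> real \<Rightarrow> real \<Rightarrow> 'a \<Rightarrow> 'e \<Rightarrow> real" where
  "step_size M f m \<epsilon> c \<alpha> t\<^sub>0 x g =
     (if \<exists>l. armijo M f m \<epsilon> c \<alpha> t\<^sub>0 x g l then t\<^sub>0 / \<alpha> ^ (LEAST l. armijo M f m \<epsilon> c \<alpha> t\<^sub>0 x g l)
      else \<epsilon> / tnorm M x g)"

definition alg_step ::
    "('a::topological_space, 'e::euclidean_space, 'z) rmanifold_scheme \<Rightarrow> (nat \<Rightarrow> 'a \<Rightarrow> real) \<Rightarrow> nat \<Rightarrow> real \<Rightarrow> real \<Rightarrow> real \<Rightarrow> real \<Rightarrow> real \<Rightarrow> 'a \<Rightarrow> 'a \<Rightarrow> bool" where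
  "alg_step M f m \<epsilon> \<delta> c \<alpha> t\<^sub>0 x x' \<longleftrightarrow>
     (\<exists>g. dd_returns M f m \<epsilon> \<delta> c x g \<and> \<not> tnorm M x g \<le> \<delta> \<and>
        x' = retr M x (step_size M f m \<epsilon> c \<alpha> t\<^sub>0 x g *\<^sub>R g))"

definition alg_stops ::
    "('a::topological_space, 'e::euclidean_space, 'z) rmanifold_scheme \<Rightarrow> (nat \<Rightarrow> 'a \<Rightarrow> real) \<Rightarrow> nat \<Rightarrow> real \<Rightarrow> real \<Rightarrow> real \<Rightarrow> 'a \<Rightarrow> bool" where
  "alg_stops M f m \<epsilon> \<delta> c x \<longleftrightarrow> (\<exists>g. dd_returns M f m \<epsilon> \<delta> c x g \<and> tnorm M x g \<le> \<delta>)"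

text \<open>\<open>generated_sequence \<dots> x\<^sub>0 X N\<close>: a possible complete execution started at \<open>x\<^sub>0\<close> generates the
  iterates \<open>X k\<close> for \<open>k \<le> N\<close> (all \<open>k\<close>, if \<open>N = \<infinity>\<close>). If \<open>N\<close> is finite, no iterate follows \<open>X N\<close>
  because either the algorithm stops there, or the loop of the descent direction procedure
  runs forever there. Including the latter case means that termination of that
  loop is not presupposed.\<close>

definition generated_sequence ::
    "('a::topological_space, 'e::euclidean_space, 'z) rmanifold_scheme \<Rightarrow> (nat \<Rightarrow> 'a \<Rightarrow> real) \<Rightarrow> nat \<Rightarrow> real \<Rightarrow> real \<Rightarrow> real \<Rightarrow> real \<Rightarrow> real \<Rightarrow> 'a \<Rightarrow> (nat \<Rightarrow> 'a) \<Rightarrow> enat \<Rightarrow> bool" where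
  "generated_sequence M f m \<epsilon> \<delta> c \<alpha> t\<^sub>0 x\<^sub>0 X N \<longleftrightarrow>
     X 0 = x\<^sub>0 \<and>
     (\<forall>k. enat k < N \<longrightarrow> alg_step M f m \<epsilon> \<delta> c \<alpha> t\<^sub>0 (X k) (X (Suc k))) \<and>
     (\<forall>n. N = enat n \<longrightarrow> alg_stops M f m \<epsilon> \<delta> c (X n) \<or> dd_diverges M f m \<epsilon> \<delta> c (X n))"

end

theory Submission
  imports Defs
begin

text \<open>An iterate that is followed by another one comes with a direction longer than \<open>\<delta>\<close> and a step of
  length at least \<open>\<epsilon>\<close>, and the step decreases every objective by at least \<open>c \<epsilon> \<delta>\<close>
  (\<open>alg_step_decrease\<close>). An objective that is bounded below can decrease by this amount only finitely
  often, so there is a last iterate \<open>x\<close>.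

  All vectors that the descent direction procedure collects at \<open>x\<close> lie in the \<open>\<epsilon>\<close>-subdifferentials
  of the objectives. If these are bounded, the procedure cannot run forever: each round adds a
  subgradient that violates the optimality condition of the current direction by a fixed margin,
  which shrinks the squared length of the direction by a fixed amount (\<open>dd_direction_shrinks\<close>). So the algorithm
  stops at \<open>x\<close> with an element of \<open>- G_eps\<close> of length at most \<open>\<delta>\<close>, and if \<open>G_eps\<close> is compact, then the
  minimum of the norm is attained.

  What needs geometry is therefore the compactness of an \<open>\<epsilon>\<close>-subdifferential, that is,
  a bound on the pulled back subgradients. Every point of the closed \<open>\<epsilon>\<close>-ball around \<open>x\<close> is
  \<open>retr M x \<eta>\<close> for some \<open>\<eta>\<close> in the compact set of tangent vectors of length at most \<open>\<epsilon>\<close>, so it suffices to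
  find a bound near each \<open>\<eta>\<^sub>0\<close>. The transport being isometric, two factors have to be bounded
  there: the subgradients themselves (\<open>subdiff_locally_bounded\<close>, because locally Lipschitz functions
  are Lipschitz in charts) and \<open>1 / beta\<close> (\<open>dretr_locally_bounded\<close>, because the retraction is
  \<open>C\<^sup>1\<close>). Both bounds compare the Riemannian norms at nearby points with one Euclidean norm, which
  \<open>inner_product_family_bounds\<close> makes possible.\<close>

section \<open>Maps with continuous derivatives\<close>

lemma Ck_on_Suc_0D:
  assumes "Ck_on (Suc 0) S f" and "x \<in> S"
  shows "(f has_derivative frechet_derivative f (at x)) (at x)"
  using assms frechet_derivative_works by auto

lemma norm_linear_le_sum_Basis:
  fixes f :: "'b::euclidean_space \<Rightarrow> 'c::real_normed_vector"
  assumes "linear f"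
  shows "norm (f v) \<le> (\<Sum>b\<in>Basis. norm (f b)) * norm v"
proof -
  have "f v = f (\<Sum>b\<in>Basis. (v \<bullet> b) *\<^sub>R b)"
    by (simp add: euclidean_representation)
  also have "\<dots> = (\<Sum>b\<in>Basis. (v \<bullet> b) *\<^sub>R f b)"
    using assms by (simp add: linear_sum linear_scale)
  also have "norm \<dots> \<le> (\<Sum>b\<in>Basis. norm v * norm (f b))"
    by (rule order.trans[OF norm_sum], rule sum_mono) (simp add: Basis_le_norm mult_right_mono)
  finally show ?thesis by (simp add: sum_distrib_left mult.commute)
qed

lemma C1_locally_bounded_derivative:
  fixes f :: "'b::euclidean_space \<Rightarrow> 'c::real_normed_vector"
  assumes "open S" and f: "Ck_on (Suc 0) S f" and "x \<in> S"
  obtains r K where "r > 0" "K > 0" "ball x r \<subseteq> S"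
    "\<And>y v. y \<in> ball x r \<Longrightarrow> norm (frechet_derivative f (at y) v) \<le> K * norm v"
proof -
  define F where "F y = (\<Sum>b\<in>Basis. norm (frechet_derivative f (at y) b))" for y
  have "continuous_on S F"
    unfolding F_def using f by (intro continuous_intros) auto
  then have "isCont F x"
    using assms by (simp add: continuous_on_eq_continuous_at)
  then have "\<forall>\<^sub>F y in nhds x. F y < F x + 1"
    using order_tendstoD(2)[of F "F x" "nhds x" "F x + 1"] by (simp add: isCont_def tendsto_nhds_iff)
  moreover have "\<forall>\<^sub>F y in nhds x. y \<in> S"
    using assms by (simp add: eventually_nhds_in_open)
  ultimately have "\<forall>\<^sub>F y in nhds x. F y < F x + 1 \<and> y \<in> S"
    by (rule eventually_conj)
  then obtain r where r: "r > 0" "\<And>y. dist y x < r \<Longrightarrow> F y < F x + 1 \<and> y \<in> S"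
    by (auto simp: eventually_nhds_metric)
  show thesis
  proof
    show "r > 0" "ball x r \<subseteq> S"
      using r by (auto simp: dist_commute)
    show "F x + 1 > 0"
      unfolding F_def by (smt (verit) norm_ge_zero sum_nonneg)
    fix y v assume "y \<in> ball x r"
    then have y: "F y < F x + 1" "y \<in> S"
      using r by (auto simp: dist_commute)
    then have "linear (frechet_derivative f (at y))"
      using Ck_on_Suc_0D[OF f] has_derivative_linear by blast
    then have "norm (frechet_derivative f (at y) v) \<le> F y * norm v"
      unfolding F_def by (rule norm_linear_le_sum_Basis)
    also have "\<dots> \<le> (F x + 1) * norm v"
      using y by (simp add: mult_right_mono)
    finally show "norm (frechet_derivative f (at y) v) \<le> (F x + 1) * norm v" .
  qed
qed

lemma C1_locally_lipschitz:
  fixes f :: "'b::euclidean_space \<Rightarrow> 'c::real_normed_vector"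
  assumes "open S" and f: "Ck_on (Suc 0) S f" and "x \<in> S"
  obtains r K where "r > 0" "K > 0" "ball x r \<subseteq> S" "K-lipschitz_on (ball x r) f"
proof -
  obtain r K where r: "r > 0" "K > 0" "ball x r \<subseteq> S"
    "\<And>y v. y \<in> ball x r \<Longrightarrow> norm (frechet_derivative f (at y) v) \<le> K * norm v"
    using C1_locally_bounded_derivative[OF assms] by blast
  have "K-lipschitz_on (ball x r) f"
  proof (rule bounded_derivative_imp_lipschitz)
    fix y assume "y \<in> ball x r"
    then show "(f has_derivative frechet_derivative f (at y)) (at y within ball x r)"
      "onorm (frechet_derivative f (at y)) \<le> K"
      using r(3,4) by (auto intro!: has_derivative_at_withinI Ck_on_Suc_0D[OF f] onorm_bound
        simp: less_imp_le[OF r(2)])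
  qed (use r in auto)
  then show thesis using r that by blast
qed


section \<open>Families of inner products\<close>

text \<open>A continuous family of inner products over a compact parameter set is uniformly
  equivalent to the Euclidean norm, because the norms attain their extrema on the compact product
  of the parameter set with the unit sphere.\<close>

lemma inner_product_family_bounds:
  fixes G :: "'p::topological_space \<Rightarrow> 'e::euclidean_space \<Rightarrow> 'e \<Rightarrow> real"
  assumes K: "compact K"
    and bil: "\<And>p. p \<in> K \<Longrightarrow> bilinear (G p)"
    and cont: "\<And>u v. continuous_on K (\<lambda>p. G p u v)"
    and pos: "\<And>p u. p \<in> K \<Longrightarrow> u \<noteq> 0 \<Longrightarrow> G p u u > 0"
  obtains l L where "l > 0" "L > 0"
    "\<And>p u. p \<in> K \<Longrightarrow> l * norm u \<le> sqrt (G p u u)"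
    "\<And>p u. p \<in> K \<Longrightarrow> sqrt (G p u u) \<le> L * norm u"
proof (cases "K = {}")
  case True
  then show thesis using that[of 1 1] by simp
next
  case False
  define N where "N = (\<lambda>(p, u). sqrt (G p u u))"
  define S where "S = K \<times> sphere (0::'e) 1"
  obtain b :: 'e where "b \<in> Basis" using nonempty_Basis by blast
  then have S: "compact S" "S \<noteq> {}"
    using K False by (auto simp: S_def compact_Times)
  have "continuous_on S
      (\<lambda>(p, u). sqrt (\<Sum>b\<in>Basis. \<Sum>b'\<in>Basis. (u \<bullet> b) * ((u \<bullet> b') * G p b b')))"
    unfolding S_def case_prod_beta
    by (intro continuous_intros continuous_on_compose2[OF cont continuous_on_fst]) auto
  moreover have "G p u u = (\<Sum>b\<in>Basis. \<Sum>b'\<in>Basis. (u \<bullet> b) * ((u \<bullet> b') * G p b b'))"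
    if "p \<in> K" for p u
  proof -
    have "G p u u = G p (\<Sum>b\<in>Basis. (u \<bullet> b) *\<^sub>R b) (\<Sum>b\<in>Basis. (u \<bullet> b) *\<^sub>R b)"
      by (simp add: euclidean_representation)
    also have "\<dots> = (\<Sum>b\<in>Basis. \<Sum>b'\<in>Basis. (u \<bullet> b) * ((u \<bullet> b') * G p b b'))"
      using bil[OF that]
      by (simp add: bilinear_sum bilinear_lmul bilinear_rmul sum.cartesian_product mult.assoc)
    finally show ?thesis .
  qed
  ultimately have contN: "continuous_on S N"
    unfolding N_def by (subst continuous_on_cong[OF refl]) (auto simp: S_def)
  obtain y z where yz: "y \<in> S" "\<And>q. q \<in> S \<Longrightarrow> N y \<le> N q" "z \<in> S" "\<And>q. q \<in> S \<Longrightarrow> N q \<le> N z"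
    using continuous_attains_inf[OF S contN] continuous_attains_sup[OF S contN] by blast
  have pos': "N q > 0" if q: "q \<in> S" for q
  proof -
    obtain p u where "q = (p, u)" "p \<in> K" "u \<noteq> 0" using q by (fastforce simp: S_def)
    then show ?thesis using pos[of p u] by (auto simp: N_def)
  qed
  have scale: "sqrt (G p u u) = norm u * N (p, u /\<^sub>R norm u)" if "p \<in> K" "u \<noteq> 0" for p u
  proof -
    have "G p u u = G p (norm u *\<^sub>R (u /\<^sub>R norm u)) (norm u *\<^sub>R (u /\<^sub>R norm u))"
      using that by simp
    also have "\<dots> = (norm u)\<^sup>2 * G p (u /\<^sub>R norm u) (u /\<^sub>R norm u)"
      by (simp only: bilinear_lmul[OF bil[OF that(1)]] bilinear_rmul[OF bil[OF that(1)]]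
        real_scaleR_def power2_eq_square mult_ac)
    finally show ?thesis by (simp add: N_def real_sqrt_mult)
  qed
  have in_S: "(p, u /\<^sub>R norm u) \<in> S" if "p \<in> K" "u \<noteq> 0" for p u
    using that by (simp add: S_def)
  have zero: "G p 0 0 = 0" if "p \<in> K" for p
    using bilinear_lzero[OF bil[OF that]] by simp
  show thesis
  proof
    show "N y > 0" "N z > 0" using pos' yz by auto
    fix p u assume p: "p \<in> K"
    show "N y * norm u \<le> sqrt (G p u u)"
      by (cases "u = 0") (use p zero scale in_S yz(2) in \<open>simp_all add: mult.commute mult_left_mono\<close>)
    show "sqrt (G p u u) \<le> N z * norm u"
      by (cases "u = 0") (use p zero scale in_S yz(4) in \<open>simp_all add: mult.commute mult_left_mono\<close>)
  qed
qed


section \<open>Charts and components of tangent vectors\<close>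

context smooth_manifold
begin

lemma chart_at_atlas: "chart_at M x \<in> atlas M"
  and chart_at_dom: "x \<in> fst (chart_at M x)"
proof -
  have "\<exists>c. c \<in> atlas M \<and> x \<in> fst c" using charts_cover by blast
  then have "chart_at M x \<in> atlas M \<and> x \<in> fst (chart_at M x)"
    unfolding chart_at_def by (rule someI_ex)
  then show "chart_at M x \<in> atlas M" "x \<in> fst (chart_at M x)" by auto
qed

lemma chart_inv_chart: "c \<in> atlas M \<Longrightarrow> x \<in> fst c \<Longrightarrow> chart_inv c (snd c x) = x"
  using chart_homeomorphism homeomorphism_apply1 by blast

lemma chart_chart_inv: "c \<in> atlas M \<Longrightarrow> p \<in> snd c ` fst c \<Longrightarrow> snd c (chart_inv c p) = p"
  using chart_homeomorphism homeomorphism_apply2 by blast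

lemma chart_inv_dom: "c \<in> atlas M \<Longrightarrow> p \<in> snd c ` fst c \<Longrightarrow> chart_inv c p \<in> fst c"
  by (auto simp: chart_inv_chart)

lemma continuous_on_chart: "c \<in> atlas M \<Longrightarrow> continuous_on (fst c) (snd c)"
  and continuous_on_chart_inv: "c \<in> atlas M \<Longrightarrow> continuous_on (snd c ` fst c) (chart_inv c)"
  using chart_homeomorphism by (auto simp: homeomorphism_def)

lemma open_chart_image:
  assumes c: "c \<in> atlas M" and "open U" "U \<subseteq> fst c"
  shows "open (snd c ` U)"
proof -
  have "openin (top_of_set (snd c ` fst c)) (snd c ` U)"
    using homeomorphism_imp_open_map[OF chart_homeomorphism[OF c]] assms
    by (simp add: openin_open_eq open_domain)
  then show ?thesis using open_range[OF c] by (simp add: openin_open_eq)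
qed

lemma chart_change_derivative:
  assumes "c \<in> atlas M" "c' \<in> atlas M" "x \<in> fst c" "x \<in> fst c'"
  shows "((snd c' \<circ> chart_inv c) has_derivative chart_change c c' x) (at (snd c x))"
proof -
  have "Ck_on (Suc 0) (snd c ` (fst c \<inter> fst c')) (snd c' \<circ> chart_inv c)"
    using charts_compatible[of c c'] assms by (simp only: smooth_on_def)
  then show ?thesis
    unfolding chart_change_def by (rule Ck_on_Suc_0D) (use assms in auto)
qed

lemma linear_chart_change:
  assumes "c \<in> atlas M" "c' \<in> atlas M" "x \<in> fst c" "x \<in> fst c'"
  shows "linear (chart_change c c' x)"
  using chart_change_derivative[OF assms] has_derivative_linear by blast

lemma chart_change_compose:
  assumes "c \<in> atlas M" "c' \<in> atlas M" "c'' \<in> atlas M" "x \<in> fst c" "x \<in> fst c'" "x \<in> fst c''"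
  shows "chart_change c' c'' x (chart_change c c' x v) = chart_change c c'' x v"
proof -
  let ?S = "snd c ` (fst c \<inter> fst c')"
  have "((snd c'' \<circ> chart_inv c') \<circ> (snd c' \<circ> chart_inv c) has_derivative
      chart_change c' c'' x \<circ> chart_change c c' x) (at (snd c x))"
    using assms
    by (intro diff_chain_at chart_change_derivative) (simp_all add: chart_inv_chart chart_change_derivative)
  moreover have "open ?S"
    using assms by (intro open_chart_image) (auto simp: open_domain)
  ultimately have "(snd c'' \<circ> chart_inv c has_derivative chart_change c' c'' x \<circ> chart_change c c' x)
      (at (snd c x))"
    by (rule has_derivative_transform_within_open) (use assms in \<open>auto simp: chart_inv_chart\<close>)
  from has_derivative_unique[OF this chart_change_derivative[OF assms(1,3,4,6)]]
  show ?thesis by (metis comp_apply)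
qed

lemma chart_change_same:
  assumes "c \<in> atlas M" "x \<in> fst c"
  shows "chart_change c c x v = v"
proof -
  have "((\<lambda>p. p) has_derivative (\<lambda>v. v)) (at (snd c x))"
    by (rule has_derivative_ident)
  then have "(snd c \<circ> chart_inv c has_derivative (\<lambda>v. v)) (at (snd c x))"
    by (rule has_derivative_transform_within_open[OF _ open_range[OF assms(1)]])
      (use assms in \<open>auto simp: chart_chart_inv\<close>)
  from has_derivative_unique[OF this chart_change_derivative[OF assms(1,1,2,2)]]
  show ?thesis by metis
qed

lemma linear_from_chart: "c \<in> atlas M \<Longrightarrow> x \<in> fst c \<Longrightarrow> linear (from_chart M c x)"
  unfolding from_chart_def by (intro linear_chart_change chart_at_atlas chart_at_dom)

lemma linear_to_chart: "c \<in> atlas M \<Longrightarrow> x \<in> fst c \<Longrightarrow> linear (to_chart M c x)"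
  unfolding to_chart_def by (intro linear_chart_change chart_at_atlas chart_at_dom)

lemma from_chart_to_chart:
  "c \<in> atlas M \<Longrightarrow> x \<in> fst c \<Longrightarrow> from_chart M c x (to_chart M c x v) = v"
  by (simp add: from_chart_def to_chart_def chart_change_compose chart_change_same
      chart_at_atlas chart_at_dom)

lemma to_chart_from_chart:
  "c \<in> atlas M \<Longrightarrow> x \<in> fst c \<Longrightarrow> to_chart M c x (from_chart M c x v) = v"
  by (simp add: from_chart_def to_chart_def chart_change_compose chart_change_same
      chart_at_atlas chart_at_dom)

lemma from_chart_chart_at: "from_chart M (chart_at M x) x v = v"
  by (simp add: from_chart_def chart_change_same chart_at_atlas chart_at_dom)

end


section \<open>Distances and locally Lipschitz functions in charts\<close>

context riemannian_manifold
begin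

lemma tnorm_nonneg: "tnorm M x v \<ge> 0"
  unfolding tnorm_def using metric_pos[of v x] bilinear_lzero[OF metric_bilinear]
  by (cases "v = 0") (auto simp: less_imp_le)

lemma tnorm_power2: "(tnorm M x v)\<^sup>2 = metric M x v v"
  using tnorm_nonneg[of x v] by (simp add: tnorm_def)

lemma tnorm_scaleR: "tnorm M x (a *\<^sub>R v) = \<bar>a\<bar> * tnorm M x v"
  by (simp add: tnorm_def bilinear_lmul[OF metric_bilinear] bilinear_rmul[OF metric_bilinear]
      real_sqrt_mult flip: mult.assoc)

lemma tnorm_minus: "tnorm M x (- v) = tnorm M x v"
  using tnorm_scaleR[of x "-1" v] by simp

lemma tnorm_zero: "tnorm M x 0 = 0"
  using tnorm_scaleR[of x 0 0] by simp

lemma tnorm_chart_bounds: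
  assumes c: "c \<in> atlas M" and "compact K" and K: "K \<subseteq> snd c ` fst c"
  obtains l L where "l > 0" "L > 0"
    "\<And>p u. p \<in> K \<Longrightarrow> l * norm u \<le> tnorm M (chart_inv c p) (from_chart M c (chart_inv c p) u)"
    "\<And>p u. p \<in> K \<Longrightarrow> tnorm M (chart_inv c p) (from_chart M c (chart_inv c p) u) \<le> L * norm u"
proof -
  define G where "G p u v =
    metric M (chart_inv c p) (from_chart M c (chart_inv c p) u) (from_chart M c (chart_inv c p) v)"
    for p u v
  have dom: "chart_inv c p \<in> fst c" if "p \<in> K" for p
    using chart_inv_dom[OF c] K that by blast
  have bil: "bilinear (G p)" if "p \<in> K" for p
    unfolding G_def bilinear_def
    using linear_from_chart[OF c dom[OF that]] metric_bilinear[of "chart_inv c p"]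
    by (auto simp: bilinear_def intro: linear_compose[unfolded o_def])
  have cont: "continuous_on K (\<lambda>p. G p u v)" for u v
  proof (rule continuous_on_subset[OF _ K])
    have "Ck_on 0 (snd c ` fst c) (\<lambda>p. G p u v)"
      using metric_smooth[OF c, of u v] by (simp only: smooth_on_def G_def)
    then show "continuous_on (snd c ` fst c) (\<lambda>p. G p u v)" by simp
  qed
  have pos: "G p u u > 0" if "p \<in> K" "u \<noteq> 0" for p u
  proof -
    have "from_chart M c (chart_inv c p) u \<noteq> 0"
      using to_chart_from_chart[OF c dom[OF that(1)], of u] that(2)
        linear_0[OF linear_to_chart[OF c dom[OF that(1)]]] by auto
    then show ?thesis unfolding G_def by (rule metric_pos)
  qed
  show thesis
    using inner_product_family_bounds[of K G, OF \<open>compact K\<close> bil cont pos] that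
    unfolding G_def tnorm_def by blast
qed

lemma tnorm_bounds:
  obtains l L where "l > 0" "L > 0" "\<And>u. l * norm u \<le> tnorm M x u" "\<And>u. tnorm M x u \<le> L * norm u"
proof -
  have "{snd (chart_at M x) x} \<subseteq> snd (chart_at M x) ` fst (chart_at M x)"
    using chart_at_dom by auto
  from tnorm_chart_bounds[OF chart_at_atlas _ this] obtain l L where "l > 0" "L > 0"
    "\<And>u. l * norm u \<le> tnorm M x (from_chart M (chart_at M x) x u)"
    "\<And>u. tnorm M x (from_chart M (chart_at M x) x u) \<le> L * norm u"
    by (metis chart_at_atlas chart_at_dom chart_inv_chart insertI1 finite.emptyI finite.insertI
        finite_imp_compact)
  then show thesis using that by (simp add: from_chart_chart_at)
qed

text \<open>The competitor in the infimum is the preimage of a straight segment of the chart.\<close>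

lemma rdist_le_in_chart:
  assumes c: "c \<in> atlas M" and B: "convex B" "open B" "B \<subseteq> snd c ` fst c"
    and L: "L \<ge> 0"
      "\<And>r u. r \<in> B \<Longrightarrow> tnorm M (chart_inv c r) (from_chart M c (chart_inv c r) u) \<le> L * norm u"
    and p: "p \<in> B" and q: "q \<in> B"
  shows "rdist M (chart_inv c p) (chart_inv c q) \<le> ennreal (L * norm (q - p))"
proof -
  define line where "line t = p + t *\<^sub>R (q - p)" for t
  define \<gamma> where "\<gamma> t = chart_inv c (line t)" for t
  have line_B: "line t \<in> B" if "t \<in> {0..1}" for t
  proof -
    have "line t = (1 - t) *\<^sub>R p + t *\<^sub>R q" by (simp add: line_def algebra_simps)
    then show ?thesis using B(1) p q that by (simp add: convex_alt)
  qed
  have \<gamma>_dom: "\<gamma> t \<in> fst c" "snd c (\<gamma> t) = line t" if "t \<in> {0..1}" for t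
    using line_B[OF that] B(3) chart_inv_dom[OF c] chart_chart_inv[OF c] by (auto simp: \<gamma>_def)
  have cont_line: "continuous_on A line" for A
    unfolding line_def by (intro continuous_intros)
  have velocity: "((snd c' \<circ> \<gamma>) has_vector_derivative chart_change c c' (\<gamma> t) (q - p)) (at t)"
    if "c' \<in> atlas M" "\<gamma> t \<in> fst c'" "t \<in> {0..1}" for c' t
  proof -
    have "(line has_derivative (\<lambda>h. h *\<^sub>R (q - p))) (at t)"
      unfolding line_def by (auto intro!: derivative_eq_intros)
    moreover have "((snd c' \<circ> chart_inv c) has_derivative chart_change c c' (\<gamma> t)) (at (line t))"
      using chart_change_derivative[OF c that(1) \<gamma>_dom(1) that(2)] that(3) \<gamma>_dom(2) by simp
    ultimately have "((snd c' \<circ> chart_inv c) \<circ> line has_derivative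
        chart_change c c' (\<gamma> t) \<circ> (\<lambda>h. h *\<^sub>R (q - p))) (at t)"
      by (rule diff_chain_at)
    moreover have "(snd c' \<circ> chart_inv c) \<circ> line = snd c' \<circ> \<gamma>"
      by (simp add: fun_eq_iff \<gamma>_def)
    moreover have "chart_change c c' (\<gamma> t) \<circ> (\<lambda>h. h *\<^sub>R (q - p)) =
        (\<lambda>h. h *\<^sub>R chart_change c c' (\<gamma> t) (q - p))"
      using linear_chart_change[OF c that(1) \<gamma>_dom(1) that(2)] that(3)
      by (simp add: fun_eq_iff linear_scale)
    ultimately show ?thesis by (simp add: has_vector_derivative_def)
  qed
  have "pw_C1_curve M \<gamma>"
    unfolding pw_C1_curve_def
  proof (intro conjI ballI allI impI)
    show "continuous_on {0..1} \<gamma>"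
      unfolding \<gamma>_def
      by (rule continuous_on_compose2[OF continuous_on_chart_inv[OF c] cont_line])
        (use line_B B(3) in blast)
    fix c' and a b :: real assume c': "c' \<in> atlas M" and ab: "{a..b} \<subseteq> {0..1} \<and> \<gamma> ` {a..b} \<subseteq> fst c'"
    have "Ck_on (Suc 0) (snd c ` (fst c \<inter> fst c')) (snd c' \<circ> chart_inv c)"
      using charts_compatible[OF c c'] by (simp only: smooth_on_def)
    then have "continuous_on (snd c ` (fst c \<inter> fst c'))
        (\<lambda>r. frechet_derivative (snd c' \<circ> chart_inv c) (at r) (q - p))"
      by simp
    moreover have "line ` {a..b} \<subseteq> snd c ` (fst c \<inter> fst c')"
    proof
      fix r assume "r \<in> line ` {a..b}"
      then obtain t where t: "t \<in> {a..b}" "r = line t" by blast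
      then have "t \<in> {0..1}" "\<gamma> t \<in> fst c'" using ab by blast+
      then show "r \<in> snd c ` (fst c \<inter> fst c')"
        using \<gamma>_dom[of t] t(2) by (intro image_eqI[of _ _ "\<gamma> t"]) auto
    qed
    ultimately have "continuous_on {a..b}
        (\<lambda>t. frechet_derivative (snd c' \<circ> chart_inv c) (at (line t)) (q - p))"
      by (rule continuous_on_compose2[OF _ cont_line])
    moreover have "frechet_derivative (snd c' \<circ> chart_inv c) (at (line t)) (q - p) =
        chart_change c c' (\<gamma> t) (q - p)" if "t \<in> {a..b}" for t
      using \<gamma>_dom(2)[of t] ab that by (auto simp: chart_change_def)
    ultimately have "continuous_on {a..b} (\<lambda>t. chart_change c c' (\<gamma> t) (q - p))"
      by (subst (asm) continuous_on_cong[OF refl])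
    then have "(snd c' \<circ> \<gamma>) C1_differentiable_on {a..b}"
      unfolding C1_differentiable_on_def
      using velocity[OF c'] ab by (intro exI[of _ "\<lambda>t. chart_change c c' (\<gamma> t) (q - p)"]) blast
    then show "(snd c' \<circ> \<gamma>) piecewise_C1_differentiable_on {a..b}"
      by (rule C1_differentiable_imp_piecewise)
  qed
  moreover have "\<gamma> 0 = chart_inv c p" "\<gamma> 1 = chart_inv c q"
    by (simp_all add: \<gamma>_def line_def)
  ultimately have "rdist M (chart_inv c p) (chart_inv c q) \<le> curve_length M \<gamma>"
    unfolding rdist_def by (intro Inf_lower) blast
  also have "\<dots> \<le> (\<integral>\<^sup>+t\<in>{0..1::real}. ennreal (L * norm (q - p)) \<partial>lborel)"
    unfolding curve_length_def
  proof (intro nn_integral_mono)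
    fix t :: real
    have "tnorm M (\<gamma> t) (vector_derivative (snd (chart_at M (\<gamma> t)) \<circ> \<gamma>) (at t)) \<le> L * norm (q - p)"
      if t: "t \<in> {0..1}"
    proof -
      have "vector_derivative (snd (chart_at M (\<gamma> t)) \<circ> \<gamma>) (at t) =
          from_chart M c (\<gamma> t) (q - p)"
        using velocity[OF chart_at_atlas chart_at_dom t] vector_derivative_at
        by (simp add: from_chart_def)
      then show ?thesis using L(2)[OF line_B[OF t]] by (simp add: \<gamma>_def)
    qed
    then show "ennreal (tnorm M (\<gamma> t) (vector_derivative (snd (chart_at M (\<gamma> t)) \<circ> \<gamma>) (at t))) *
        indicator {0..1} t \<le> ennreal (L * norm (q - p)) * indicator {0..1} t"
      by (auto simp: indicator_def ennreal_leI)
  qed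
  also have "\<dots> = ennreal (L * norm (q - p))"
    by (simp add: nn_integral_cmult_indicator)
  finally show ?thesis .
qed

lemma locally_lipschitz_in_chart:
  assumes f: "locally_lipschitz M f" and c: "c \<in> atlas M" and x: "x \<in> fst c"
  obtains r K where "r > 0" "K > 0" "ball (snd c x) r \<subseteq> snd c ` fst c"
    "K-lipschitz_on (ball (snd c x) r) (f \<circ> chart_inv c)"
proof -
  have "\<exists>U L. open U \<and> x \<in> U \<and> L > 0 \<and>
      (\<forall>y\<in>U. \<forall>z\<in>U. ennreal \<bar>f z - f y\<bar> \<le> ennreal L * rdist M z y)"
    using f unfolding locally_lipschitz_def by (rule spec)
  then obtain U L where U: "open U" "x \<in> U" "L > 0"
    "\<And>y z. y \<in> U \<Longrightarrow> z \<in> U \<Longrightarrow> ennreal \<bar>f z - f y\<bar> \<le> ennreal L * rdist M z y"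
    by auto
  have "open (snd c ` (fst c \<inter> U))"
    using c U by (intro open_chart_image) (auto simp: open_domain)
  moreover have "snd c x \<in> snd c ` (fst c \<inter> U)" using x U by blast
  ultimately obtain r where r: "r > 0" "cball (snd c x) r \<subseteq> snd c ` (fst c \<inter> U)"
    using open_contains_cball by blast
  then have sub: "cball (snd c x) r \<subseteq> snd c ` fst c" by blast
  obtain l K where "l > 0" and K: "K > 0"
    and "\<And>p u. p \<in> cball (snd c x) r \<Longrightarrow>
      l * norm u \<le> tnorm M (chart_inv c p) (from_chart M c (chart_inv c p) u)"
    and K': "\<And>p u. p \<in> cball (snd c x) r \<Longrightarrow>
      tnorm M (chart_inv c p) (from_chart M c (chart_inv c p) u) \<le> K * norm u"
    by (rule tnorm_chart_bounds[OF c compact_cball sub]) (rule that)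
  have ball: "ball (snd c x) r \<subseteq> snd c ` fst c" using sub by auto
  have "(L * K)-lipschitz_on (ball (snd c x) r) (f \<circ> chart_inv c)"
  proof (rule lipschitz_onI)
    fix p q assume pq: "p \<in> ball (snd c x) r" "q \<in> ball (snd c x) r"
    then have "chart_inv c p \<in> U" "chart_inv c q \<in> U"
      using r(2) by (auto simp: subset_iff image_iff chart_inv_chart[OF c] dest!: less_imp_le)
    then have "ennreal \<bar>f (chart_inv c p) - f (chart_inv c q)\<bar>
        \<le> ennreal L * rdist M (chart_inv c p) (chart_inv c q)"
      using U(4) by blast
    also have "\<dots> \<le> ennreal L * ennreal (K * norm (q - p))"
      using pq K K' ball
      by (intro mult_left_mono rdist_le_in_chart[OF c convex_ball open_ball]) auto
    also have "\<dots> = ennreal (L * K * dist p q)"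
      using U(3) K by (simp add: dist_norm norm_minus_commute mult.assoc flip: ennreal_mult)
    finally show "dist ((f \<circ> chart_inv c) p) ((f \<circ> chart_inv c) q) \<le> L * K * dist p q"
      using U(3) K by (subst (asm) ennreal_le_iff) (auto simp: dist_norm)
  qed (use U K in simp)
  then show thesis using that[of r "L * K"] r ball U K by simp
qed

end


section \<open>The retraction in charts\<close>

context retraction_manifold
begin

definition retr_chart :: "('a, 'b) chart \<Rightarrow> ('a, 'b) chart \<Rightarrow> 'b \<times> 'b \<Rightarrow> 'b" where
  "retr_chart c c' = (\<lambda>(p, u). snd c' (retr M (chart_inv c p) (from_chart M c (chart_inv c p) u)))"

lemma open_retr_dom: "c \<in> atlas M \<Longrightarrow> c' \<in> atlas M \<Longrightarrow> open (retr_dom M c c')"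
  using retr_smooth by (simp add: retr_smooth_def)

lemma C1_retr_chart:
  assumes "c \<in> atlas M" "c' \<in> atlas M"
  shows "Ck_on (Suc 0) (retr_dom M c c') (retr_chart c c')"
proof -
  have "smooth_on (retr_dom M c c') (retr_chart c c')"
    unfolding retr_chart_def using retr_smooth assms by (simp add: retr_smooth_def)
  then show ?thesis by (simp only: smooth_on_def)
qed

lemma mem_retr_dom:
  assumes "c \<in> atlas M" "x \<in> fst c"
  shows "(snd c x, u) \<in> retr_dom M c c' \<longleftrightarrow> retr M x (from_chart M c x u) \<in> fst c'"
  using assms by (auto simp: retr_dom_def chart_inv_chart)

lemma retr_chart_apply:
  assumes "c \<in> atlas M" "x \<in> fst c"
  shows "retr_chart c c' (snd c x, u) = snd c' (retr M x (from_chart M c x u))"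
  using assms by (simp add: retr_chart_def chart_inv_chart)

lemma mem_retr_dom_chart_at:
  "(snd (chart_at M x) x, u) \<in> retr_dom M (chart_at M x) c' \<longleftrightarrow> retr M x u \<in> fst c'"
  by (simp add: mem_retr_dom chart_at_atlas chart_at_dom from_chart_chart_at)

lemma retr_chart_chart_at:
  "retr_chart (chart_at M x) c' (snd (chart_at M x) x, u) = snd c' (retr M x u)"
  by (simp add: retr_chart_apply chart_at_atlas chart_at_dom from_chart_chart_at)

lemma open_retr_preimage_chart:
  assumes "c' \<in> atlas M"
  shows "open {u. retr M x u \<in> fst c'}"
proof -
  let ?g = "\<lambda>u. (snd (chart_at M x) x, u)"
  have "open (?g -` retr_dom M (chart_at M x) c')"
    by (intro open_vimage open_retr_dom chart_at_atlas assms continuous_intros)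
  then show ?thesis by (simp add: vimage_def mem_retr_dom_chart_at)
qed

lemma continuous_on_retr: "continuous_on UNIV (retr M x)"
proof (rule continuous_at_imp_continuous_on, rule ballI)
  fix \<eta>
  let ?c = "chart_at M x" and ?c' = "chart_at M (retr M x \<eta>)"
  let ?S = "{u. retr M x u \<in> fst ?c'}" and ?\<Phi> = "\<lambda>u. retr_chart ?c ?c' (snd ?c x, u)"
  have "continuous_on (retr_dom M ?c ?c') (retr_chart ?c ?c')"
    using Ck_on_Suc_0D[OF C1_retr_chart[OF chart_at_atlas chart_at_atlas]]
    by (intro continuous_at_imp_continuous_on ballI has_derivative_continuous) blast
  then have "continuous_on ?S ?\<Phi>"
    by (rule continuous_on_compose2) (auto intro!: continuous_intros simp: mem_retr_dom_chart_at)
  then have "continuous_on ?S (\<lambda>u. chart_inv ?c' (?\<Phi> u))"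
    by (rule continuous_on_compose2[OF continuous_on_chart_inv[OF chart_at_atlas]])
      (auto simp: retr_chart_chart_at)
  then have "continuous_on ?S (retr M x)"
    by (subst (asm) continuous_on_cong[OF refl])
      (auto simp: retr_chart_chart_at chart_inv_chart chart_at_atlas)
  then show "isCont (retr M x) \<eta>"
    using open_retr_preimage_chart[OF chart_at_atlas] chart_at_dom
    by (auto simp: continuous_on_eq_continuous_at)
qed

text \<open>The components of \<open>dretr M x \<eta> \<zeta>\<close> may jump with \<open>\<eta>\<close>, because \<open>chart_at M (retr M x \<eta>)\<close> may. In one fixed
  chart around \<open>retr M x \<eta>\<^sub>0\<close>, however, the derivative and the metric both depend continuously on
  \<open>\<eta>\<close>, and the Riemannian norm is the same in all charts.\<close>

lemma dretr_locally_bounded: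
  obtains r K where "r > 0" "K > 0"
    "\<And>\<eta> \<zeta>. \<eta> \<in> ball \<eta>\<^sub>0 r \<Longrightarrow> tnorm M (retr M x \<eta>) (dretr M x \<eta> \<zeta>) \<le> K * norm \<zeta>"
proof -
  define c where "c = chart_at M x"
  define c' where "c' = chart_at M (retr M x \<eta>\<^sub>0)"
  define p where "p = snd c x"
  define \<psi> where "\<psi> \<eta> = snd c' (retr M x \<eta>)" for \<eta>
  have c: "c \<in> atlas M" "c' \<in> atlas M"
    by (simp_all add: c_def c'_def chart_at_atlas)
  have dom: "(p, \<eta>) \<in> retr_dom M c c' \<longleftrightarrow> retr M x \<eta> \<in> fst c'" for \<eta>
    unfolding p_def c_def by (rule mem_retr_dom_chart_at)
  have \<psi>: "\<psi> \<eta> = retr_chart c c' (p, \<eta>)" for \<eta>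
    by (simp add: \<psi>_def p_def c_def retr_chart_chart_at)
  have \<eta>\<^sub>0: "retr M x \<eta>\<^sub>0 \<in> fst c'" by (simp add: c'_def chart_at_dom)
  define D where "D q = frechet_derivative (retr_chart c c') (at q)" for q
  obtain r\<^sub>1 K\<^sub>1 where r\<^sub>1: "r\<^sub>1 > 0" "K\<^sub>1 > 0" "ball (p, \<eta>\<^sub>0) r\<^sub>1 \<subseteq> retr_dom M c c'"
    "\<And>q v. q \<in> ball (p, \<eta>\<^sub>0) r\<^sub>1 \<Longrightarrow> norm (D q v) \<le> K\<^sub>1 * norm v"
    unfolding D_def
    by (rule C1_locally_bounded_derivative[OF open_retr_dom[OF c] C1_retr_chart[OF c], of "(p, \<eta>\<^sub>0)"])
      (use \<eta>\<^sub>0 dom in auto)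
  obtain \<rho> where \<rho>: "\<rho> > 0" "cball (\<psi> \<eta>\<^sub>0) \<rho> \<subseteq> snd c' ` fst c'"
    using open_range[OF c(2)] \<eta>\<^sub>0 unfolding open_contains_cball \<psi>_def by blast
  obtain l L where "l > 0" and L: "L > 0"
    and "\<And>q u. q \<in> cball (\<psi> \<eta>\<^sub>0) \<rho> \<Longrightarrow>
      l * norm u \<le> tnorm M (chart_inv c' q) (from_chart M c' (chart_inv c' q) u)"
    and L': "\<And>q u. q \<in> cball (\<psi> \<eta>\<^sub>0) \<rho> \<Longrightarrow>
      tnorm M (chart_inv c' q) (from_chart M c' (chart_inv c' q) u) \<le> L * norm u"
    by (rule tnorm_chart_bounds[OF c(2) compact_cball \<rho>(2)]) (rule that)
  have der: "(\<psi> has_derivative (\<lambda>\<zeta>. D (p, \<eta>) (0, \<zeta>))) (at \<eta>)" if "retr M x \<eta> \<in> fst c'" for \<eta>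
  proof -
    have "((\<lambda>\<eta>. (p, \<eta>)) has_derivative (\<lambda>\<zeta>. (0, \<zeta>))) (at \<eta>)"
      by (auto intro!: derivative_eq_intros)
    moreover have "(retr_chart c c' has_derivative D (p, \<eta>)) (at (p, \<eta>))"
      unfolding D_def using that dom by (intro Ck_on_Suc_0D[OF C1_retr_chart[OF c]]) simp
    ultimately have "(retr_chart c c' \<circ> (\<lambda>\<eta>. (p, \<eta>)) has_derivative D (p, \<eta>) \<circ> (\<lambda>\<zeta>. (0, \<zeta>))) (at \<eta>)"
      by (rule diff_chain_at)
    moreover have "retr_chart c c' \<circ> (\<lambda>\<eta>. (p, \<eta>)) = \<psi>" by (simp add: fun_eq_iff \<psi>)
    ultimately show ?thesis by (simp add: o_def)
  qed
  have dretr: "dretr M x \<eta> \<zeta> = from_chart M c' (retr M x \<eta>) (D (p, \<eta>) (0, \<zeta>))"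
    if y: "retr M x \<eta> \<in> fst c'" for \<eta> \<zeta>
  proof -
    let ?c = "chart_at M (retr M x \<eta>)"
    have "((snd ?c \<circ> chart_inv c') has_derivative from_chart M c' (retr M x \<eta>)) (at (\<psi> \<eta>))"
      unfolding \<psi>_def from_chart_def
      by (intro chart_change_derivative c(2) y chart_at_atlas chart_at_dom)
    with der[OF y] have "((snd ?c \<circ> chart_inv c') \<circ> \<psi> has_derivative
        from_chart M c' (retr M x \<eta>) \<circ> (\<lambda>\<zeta>. D (p, \<eta>) (0, \<zeta>))) (at \<eta>)"
      by (rule diff_chain_at)
    then have "((\<lambda>\<eta>. snd ?c (retr M x \<eta>)) has_derivative
        from_chart M c' (retr M x \<eta>) \<circ> (\<lambda>\<zeta>. D (p, \<eta>) (0, \<zeta>))) (at \<eta>)"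
      by (rule has_derivative_transform_within_open[OF _ open_retr_preimage_chart[OF c(2), of x]])
        (use y in \<open>auto simp: \<psi>_def chart_inv_chart[OF c(2)]\<close>)
    from frechet_derivative_at[OF this] show ?thesis
      by (simp add: dretr_def fun_eq_iff)
  qed
  have "isCont \<psi> \<eta>\<^sub>0" using der[OF \<eta>\<^sub>0] by (rule has_derivative_continuous)
  then obtain r\<^sub>2 where r\<^sub>2: "r\<^sub>2 > 0" "\<And>\<eta>. dist \<eta> \<eta>\<^sub>0 < r\<^sub>2 \<Longrightarrow> dist (\<psi> \<eta>) (\<psi> \<eta>\<^sub>0) < \<rho>"
    unfolding continuous_at_eps_delta using \<rho>(1) by blast
  show thesis
  proof
    show "min r\<^sub>1 r\<^sub>2 > 0" "L * K\<^sub>1 > 0" using r\<^sub>1 r\<^sub>2 L by auto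
    fix \<eta> \<zeta> assume \<eta>: "\<eta> \<in> ball \<eta>\<^sub>0 (min r\<^sub>1 r\<^sub>2)"
    then have ball: "(p, \<eta>) \<in> ball (p, \<eta>\<^sub>0) r\<^sub>1" by (simp add: dist_Pair_Pair)
    then have y: "retr M x \<eta> \<in> fst c'" using r\<^sub>1(3) dom by blast
    have "\<psi> \<eta> \<in> cball (\<psi> \<eta>\<^sub>0) \<rho>" using r\<^sub>2(2)[of \<eta>] \<eta> by (auto simp: dist_commute)
    moreover have "chart_inv c' (\<psi> \<eta>) = retr M x \<eta>"
      by (simp add: \<psi>_def chart_inv_chart[OF c(2) y])
    ultimately have "tnorm M (retr M x \<eta>) (dretr M x \<eta> \<zeta>) \<le> L * norm (D (p, \<eta>) (0, \<zeta>))"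
      using L'[of "\<psi> \<eta>"] by (simp add: dretr[OF y])
    also have "\<dots> \<le> L * (K\<^sub>1 * norm (0::'b, \<zeta>))"
      using r\<^sub>1(4)[OF ball, of "(0, \<zeta>)"] L by (simp only: mult_left_mono less_imp_le)
    finally show "tnorm M (retr M x \<eta>) (dretr M x \<eta> \<zeta>) \<le> L * K\<^sub>1 * norm \<zeta>"
      by (simp add: norm_Pair)
  qed
qed


text \<open>In a bundle chart around \<open>y\<^sub>0\<close>, the function \<open>(y, h) \<mapsto> f (retr M y h)\<close> is a Lipschitz function
  composed with a \<open>C\<^sup>1\<close> map, hence Lipschitz near \<open>(y\<^sub>0, 0)\<close>. The Lipschitz constant bounds all the
  subgradients at points \<open>y\<close> near \<open>y\<^sub>0\<close> at once.\<close>

lemma subdiff_locally_bounded: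
  assumes f: "locally_lipschitz M f"
  obtains V C where "open V" "y\<^sub>0 \<in> V" "C > 0"
    "\<And>y \<xi>. y \<in> V \<Longrightarrow> \<xi> \<in> subdiff M f y \<Longrightarrow> tnorm M y \<xi> \<le> C"
proof -
  define c where "c = chart_at M y\<^sub>0"
  define p\<^sub>0 where "p\<^sub>0 = snd c y\<^sub>0"
  define \<Phi> where "\<Phi> = retr_chart c c"
  define F where "F = f \<circ> chart_inv c"
  have c: "c \<in> atlas M" and y\<^sub>0: "y\<^sub>0 \<in> fst c"
    by (simp_all add: c_def chart_at_atlas chart_at_dom)
  obtain \<rho> K\<^sub>1 where \<rho>: "\<rho> > 0" "K\<^sub>1 > 0" "K\<^sub>1-lipschitz_on (ball p\<^sub>0 \<rho>) F"
    using locally_lipschitz_in_chart[OF f c y\<^sub>0] unfolding p\<^sub>0_def F_def by metis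
  have zero: "(p\<^sub>0, 0) \<in> retr_dom M c c" and \<Phi>_zero: "\<Phi> (p\<^sub>0, 0) = p\<^sub>0"
    unfolding p\<^sub>0_def \<Phi>_def c_def
    by (simp_all add: mem_retr_dom_chart_at retr_chart_chart_at retr_zero chart_at_dom)
  obtain r\<^sub>1 K\<^sub>2 where r\<^sub>1: "r\<^sub>1 > 0" "K\<^sub>2 > 0" "ball (p\<^sub>0, 0) r\<^sub>1 \<subseteq> retr_dom M c c"
      "K\<^sub>2-lipschitz_on (ball (p\<^sub>0, 0) r\<^sub>1) \<Phi>"
    by (rule C1_locally_lipschitz[OF open_retr_dom[OF c c]
          C1_retr_chart[OF c c, folded \<Phi>_def] zero]) (rule that)
  (* small enough for \<Phi> to map the r-ball into the ball on which F is Lipschitz *)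
  define r where "r = min r\<^sub>1 (\<rho> / K\<^sub>2)"
  have r: "r > 0" "r \<le> r\<^sub>1" "K\<^sub>2 * r \<le> \<rho>"
    using r\<^sub>1 \<rho> by (auto simp: r_def min_def field_simps)
  have ball_r: "q \<in> ball (p\<^sub>0, 0) r\<^sub>1" if "q \<in> ball (p\<^sub>0, 0) r" for q
    using that r by auto
  have \<Phi>_ball: "\<Phi> q \<in> ball p\<^sub>0 \<rho>" if q: "q \<in> ball (p\<^sub>0, 0) r" for q
  proof -
    have "dist (\<Phi> (p\<^sub>0, 0)) (\<Phi> q) \<le> K\<^sub>2 * dist (p\<^sub>0, 0) q"
      using r\<^sub>1 ball_r[OF q] by (intro lipschitz_onD[OF r\<^sub>1(4)]) auto
    also have "\<dots> < K\<^sub>2 * r" using q r\<^sub>1(2) by (intro mult_strict_left_mono) auto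
    finally show ?thesis using r(3) by (simp add: \<Phi>_zero)
  qed
  have lip: "\<bar>F (\<Phi> q) - F (\<Phi> q')\<bar> \<le> K\<^sub>1 * K\<^sub>2 * dist q q'"
    if q: "q \<in> ball (p\<^sub>0, 0) r" "q' \<in> ball (p\<^sub>0, 0) r" for q q'
  proof -
    have "dist (F (\<Phi> q)) (F (\<Phi> q')) \<le> K\<^sub>1 * dist (\<Phi> q) (\<Phi> q')"
      using \<Phi>_ball q by (intro lipschitz_onD[OF \<rho>(3)])
    also have "\<dots> \<le> K\<^sub>1 * (K\<^sub>2 * dist q q')"
      using \<rho>(2) q by (intro mult_left_mono lipschitz_onD[OF r\<^sub>1(4)] ball_r less_imp_le)
    finally show ?thesis by (simp add: dist_real_def)
  qed
  have sub: "cball p\<^sub>0 (r / 2) \<subseteq> snd c ` fst c"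
  proof
    fix p assume "p \<in> cball p\<^sub>0 (r / 2)"
    then have "(p, 0) \<in> ball (p\<^sub>0, 0) r" using r(1) by (auto simp: dist_Pair_Pair)
    then have "(p, 0) \<in> retr_dom M c c" using ball_r r\<^sub>1(3) by blast
    then show "p \<in> snd c ` fst c" by (simp add: retr_dom_def)
  qed
  obtain l L where l: "l > 0" and "L > 0"
    and l': "\<And>p u. p \<in> cball p\<^sub>0 (r / 2) \<Longrightarrow>
      l * norm u \<le> tnorm M (chart_inv c p) (from_chart M c (chart_inv c p) u)"
    and "\<And>p u. p \<in> cball p\<^sub>0 (r / 2) \<Longrightarrow>
      tnorm M (chart_inv c p) (from_chart M c (chart_inv c p) u) \<le> L * norm u"
    by (rule tnorm_chart_bounds[OF c compact_cball sub]) (rule that)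
  show thesis
  proof
    show "open (fst c \<inter> snd c -` ball p\<^sub>0 (r / 2))"
      by (intro continuous_open_preimage continuous_on_chart open_domain c open_ball)
    show "y\<^sub>0 \<in> fst c \<inter> snd c -` ball p\<^sub>0 (r / 2)"
      using y\<^sub>0 r(1) by (simp add: p\<^sub>0_def)
    show "K\<^sub>1 * K\<^sub>2 / l > 0" using \<rho> r\<^sub>1 l by simp
    fix y \<xi> assume y: "y \<in> fst c \<inter> snd c -` ball p\<^sub>0 (r / 2)" and \<xi>: "\<xi> \<in> subdiff M f y"
    then have yc: "y \<in> fst c" and p: "dist (snd c y) p\<^sub>0 < r / 2" by (auto simp: dist_commute)
    define u where "u = to_chart M c y"
    have lin: "linear u" unfolding u_def by (rule linear_to_chart[OF c yc])
    (* half of the radius is spent on moving the base point, the other half on the tangent vector *)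
    have in_ball: "(snd c y, w) \<in> ball (p\<^sub>0, 0) r" if "norm w < r / 2" for w
      using norm_Pair_le[of "p\<^sub>0 - snd c y" "- w"] p that
      by (simp add: dist_norm norm_minus_commute)
    have F\<Phi>: "f (retr M y h) = F (\<Phi> (snd c y, u h))" if "norm (u h) < r / 2" for h
    proof -
      have "(snd c y, u h) \<in> retr_dom M c c"
        using in_ball[OF that] ball_r r\<^sub>1(3) by blast
      then show ?thesis
        by (simp add: F_def \<Phi>_def u_def mem_retr_dom retr_chart_apply c yc from_chart_to_chart
            chart_inv_chart)
    qed
    (* in the direction \<xi> itself, the Clarke inequality bounds the squared norm of \<xi> *)
    have "((\<lambda>q. u (fst q) + snd q *\<^sub>R u \<xi>) \<longlongrightarrow> u 0 + 0 *\<^sub>R u \<xi>) (nhds 0 \<times>\<^sub>F at_right (0::real))"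
      by (intro tendsto_intros bounded_linear.tendsto[OF linear_conv_bounded_linear[THEN iffD1, OF lin]]
          filterlim_fst filterlim_mono[OF filterlim_snd at_within_le_nhds order_refl])
    moreover have "((\<lambda>q. u (fst q)) \<longlongrightarrow> u 0) (nhds 0 \<times>\<^sub>F at_right (0::real))"
      by (intro bounded_linear.tendsto[OF linear_conv_bounded_linear[THEN iffD1, OF lin]] filterlim_fst)
    moreover have "u 0 = 0" using lin by (rule linear_0)
    ultimately have
      "\<forall>\<^sub>F q in nhds 0 \<times>\<^sub>F at_right (0::real). norm (u (fst q) + snd q *\<^sub>R u \<xi>) < r / 2"
      "\<forall>\<^sub>F q in nhds 0 \<times>\<^sub>F at_right (0::real). norm (u (fst q)) < r / 2"
      using r(1) by (auto dest!: tendstoD[where e = "r / 2"])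
    moreover have "\<forall>\<^sub>F q in nhds (0::'b) \<times>\<^sub>F at_right (0::real). snd q > 0"
      by (rule eventually_compose_filterlim[OF eventually_at_right_less filterlim_snd])
    ultimately have "\<forall>\<^sub>F q in nhds 0 \<times>\<^sub>F at_right (0::real).
      (case q of (h, t) \<Rightarrow> ereal (((f \<circ> retr M y) (h + t *\<^sub>R \<xi>) - (f \<circ> retr M y) h) / t))
        \<le> ereal (K\<^sub>1 * K\<^sub>2 * norm (u \<xi>))"
    proof eventually_elim
      case (elim q)
      obtain h t where q: "q = (h, t)" by force
      have u: "u (h + t *\<^sub>R \<xi>) = u h + t *\<^sub>R u \<xi>"
        using lin by (simp add: linear_add linear_scale)
      have "f (retr M y (h + t *\<^sub>R \<xi>)) - f (retr M y h)
          \<le> K\<^sub>1 * K\<^sub>2 * dist (snd c y, u h + t *\<^sub>R u \<xi>) (snd c y, u h)"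
        using elim lip[OF in_ball in_ball, of "u h + t *\<^sub>R u \<xi>" "u h"]
        by (simp add: q F\<Phi> u)
      also have "\<dots> = K\<^sub>1 * K\<^sub>2 * norm (u \<xi>) * t"
        using elim by (simp add: q dist_Pair_Pair dist_norm)
      finally show ?case using elim by (simp add: q pos_divide_le_eq)
    qed
    then have "clarke_derivative (f \<circ> retr M y) 0 \<xi> \<le> ereal (K\<^sub>1 * K\<^sub>2 * norm (u \<xi>))"
      unfolding clarke_derivative_def by (rule Limsup_bounded)
    moreover have "ereal (metric M y \<xi> \<xi>) \<le> clarke_derivative (f \<circ> retr M y) 0 \<xi>"
      using \<xi> by (simp add: subdiff_def clarke_subdiff_def)
    ultimately have "ereal (metric M y \<xi> \<xi>) \<le> ereal (K\<^sub>1 * K\<^sub>2 * norm (u \<xi>))"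
      by (rule order.trans[rotated])
    then have "(tnorm M y \<xi>)\<^sup>2 \<le> K\<^sub>1 * K\<^sub>2 * norm (u \<xi>)"
      by (simp add: tnorm_power2)
    also have "norm (u \<xi>) \<le> tnorm M y \<xi> / l"
      using l'[of "snd c y" "u \<xi>"] p l
      by (simp add: u_def dist_commute chart_inv_chart c yc from_chart_to_chart field_simps)
    finally have "tnorm M y \<xi> * tnorm M y \<xi> \<le> K\<^sub>1 * K\<^sub>2 / l * tnorm M y \<xi>"
      using \<rho>(2) r\<^sub>1(2) by (simp add: power2_eq_square mult_left_mono)
    then show "tnorm M y \<xi> \<le> K\<^sub>1 * K\<^sub>2 / l"
      using tnorm_nonneg[of y \<xi>] \<open>K\<^sub>1 * K\<^sub>2 / l > 0\<close>
        mult_right_le_imp_le[of "tnorm M y \<xi>" "tnorm M y \<xi>" "K\<^sub>1 * K\<^sub>2 / l"]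
      by (cases "tnorm M y \<xi> = 0") linarith+
  qed
qed

end

section \<open>Compactness of the \<open>\<epsilon>\<close>-subdifferentials\<close>

context transport_manifold
begin

lemma tnorm_inv_transp: "tnorm M x (inv (transp M x \<eta>) \<xi>) = tnorm M (retr M x \<eta>) \<xi>"
proof -
  have iso: "tnorm M (retr M x \<eta>) (transp M x \<eta> v) = tnorm M x v" for v
    by (simp add: tnorm_def transp_isometric)
  have "v = 0" if "transp M x \<eta> v = 0" for v
    using iso[of v] that metric_pos[of v x] tnorm_power2[of x v] by (cases "v = 0") (auto simp: tnorm_zero)
  then have "inj (transp M x \<eta>)"
    using linear_injective_0[OF transp_linear] by blast
  then have "surj (transp M x \<eta>)"
    using linear_injective_imp_surjective[OF transp_linear] by blast
  then show ?thesis using iso[of "inv (transp M x \<eta>) \<xi>"] by (simp add: surj_f_inv_f)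
qed

text \<open>The vectors are written with the tangent vector \<open>\<eta>\<close> instead of the point \<open>retr M x \<eta>\<close>, because
  the local bounds are patched together over a compact set of tangent vectors.\<close>

lemma pulled_back_subgradients_locally_bounded:
  assumes f: "locally_lipschitz M f"
  obtains r C where "r > 0"
    "\<And>\<eta> \<xi>. \<eta> \<in> ball \<eta>\<^sub>0 r \<Longrightarrow> \<xi> \<in> subdiff M f (retr M x \<eta>) \<Longrightarrow>
      tnorm M x (inverse (beta M x \<eta>) *\<^sub>R inv (transp M x \<eta>) \<xi>) \<le> C"
proof -
  obtain r\<^sub>1 K where r\<^sub>1: "r\<^sub>1 > 0" "K > 0"
    "\<And>\<eta> \<zeta>. \<eta> \<in> ball \<eta>\<^sub>0 r\<^sub>1 \<Longrightarrow> tnorm M (retr M x \<eta>) (dretr M x \<eta> \<zeta>) \<le> K * norm \<zeta>"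
    by (rule dretr_locally_bounded) (rule that)
  obtain V C where V: "open V" "retr M x \<eta>\<^sub>0 \<in> V" "C > 0"
    "\<And>y \<xi>. y \<in> V \<Longrightarrow> \<xi> \<in> subdiff M f y \<Longrightarrow> tnorm M y \<xi> \<le> C"
    by (rule subdiff_locally_bounded[OF f]) (rule that)
  obtain l L where l: "l > 0" and "L > 0" and l': "\<And>u. l * norm u \<le> tnorm M x u"
    and "\<And>u. tnorm M x u \<le> L * norm u"
    by (rule tnorm_bounds) (rule that)
  have "open (retr M x -` V)"
    using continuous_on_retr V(1) by (simp add: continuous_on_open_vimage)
  then obtain r\<^sub>2 where r\<^sub>2: "r\<^sub>2 > 0" "ball \<eta>\<^sub>0 r\<^sub>2 \<subseteq> retr M x -` V"
    using V(2) by (meson open_contains_ball vimageI2)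
  show thesis
  proof
    show "min r\<^sub>1 r\<^sub>2 > 0" using r\<^sub>1 r\<^sub>2 by simp
    fix \<eta> \<xi> assume \<eta>: "\<eta> \<in> ball \<eta>\<^sub>0 (min r\<^sub>1 r\<^sub>2)" and \<xi>: "\<xi> \<in> subdiff M f (retr M x \<eta>)"
    have beta: "\<bar>inverse (beta M x \<eta>)\<bar> \<le> max 1 (K / l)"
    proof (cases "\<eta> = 0")
      case False
      then have n: "norm \<eta> > 0" by simp
      have "tnorm M (retr M x \<eta>) (dretr M x \<eta> \<eta>) / tnorm M x \<eta> \<le> (K * norm \<eta>) / (l * norm \<eta>)"
        using r\<^sub>1(2) r\<^sub>1(3)[of \<eta> \<eta>] \<eta> l l'[of \<eta>] n by (intro frac_le) auto
      also have "\<dots> = K / l" using n by simp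
      finally show ?thesis using False by (simp add: beta_def tnorm_nonneg abs_of_nonneg)
    qed (simp add: beta_def)
    have "tnorm M x (inverse (beta M x \<eta>) *\<^sub>R inv (transp M x \<eta>) \<xi>) =
        \<bar>inverse (beta M x \<eta>)\<bar> * tnorm M (retr M x \<eta>) \<xi>"
      by (simp only: tnorm_scaleR tnorm_inv_transp)
    also have "\<dots> \<le> max 1 (K / l) * C"
      using \<eta> \<xi> r\<^sub>2(2) V(4) by (intro mult_mono beta) (auto simp: tnorm_nonneg le_max_iff_disj)
    finally show "tnorm M x (inverse (beta M x \<eta>) *\<^sub>R inv (transp M x \<eta>) \<xi>) \<le> max 1 (K / l) * C" .
  qed
qed

lemma continuous_on_tnorm: "continuous_on S (tnorm M x)"
  unfolding tnorm_def
  by (intro continuous_intros bilinear_continuous_on_compose[OF _ _ metric_bilinear])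

lemma compact_tnorm_cball: "compact {\<eta>. tnorm M x \<eta> \<le> \<epsilon>}"
proof -
  obtain l L where l: "l > 0" and "L > 0" and l': "\<And>u. l * norm u \<le> tnorm M x u"
    and "\<And>u. tnorm M x u \<le> L * norm u"
    by (rule tnorm_bounds) (rule that)
  have "norm \<eta> \<le> \<epsilon> / l" if "tnorm M x \<eta> \<le> \<epsilon>" for \<eta>
    using l l'[of \<eta>] that by (simp add: field_simps)
  then have "bounded {\<eta>. tnorm M x \<eta> \<le> \<epsilon>}"
    by (auto simp: bounded_iff)
  moreover have "closed {\<eta>. tnorm M x \<eta> \<le> \<epsilon>}"
    by (intro closed_Collect_le continuous_on_tnorm continuous_intros)
  ultimately show ?thesis by (simp add: compact_eq_bounded_closed)
qed

lemma pulled_back_subgradients_bounded: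
  assumes f: "locally_lipschitz M f"
  obtains C where
    "\<And>\<eta> \<xi>. tnorm M x \<eta> \<le> \<epsilon> \<Longrightarrow> \<xi> \<in> subdiff M f (retr M x \<eta>) \<Longrightarrow>
      tnorm M x (inverse (beta M x \<eta>) *\<^sub>R inv (transp M x \<eta>) \<xi>) \<le> C"
proof -
  let ?v = "\<lambda>\<eta> \<xi>. tnorm M x (inverse (beta M x \<eta>) *\<^sub>R inv (transp M x \<eta>) \<xi>)"
  have "\<forall>\<eta>\<^sub>0. \<exists>r C. r > 0 \<and> (\<forall>\<eta>\<in>ball \<eta>\<^sub>0 r. \<forall>\<xi>\<in>subdiff M f (retr M x \<eta>). ?v \<eta> \<xi> \<le> C)"
    by (metis pulled_back_subgradients_locally_bounded[OF f])
  then obtain r C where r: "\<And>\<eta>\<^sub>0. r \<eta>\<^sub>0 > 0"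
    "\<And>\<eta>\<^sub>0 \<eta> \<xi>. \<eta> \<in> ball \<eta>\<^sub>0 (r \<eta>\<^sub>0) \<Longrightarrow> \<xi> \<in> subdiff M f (retr M x \<eta>) \<Longrightarrow> ?v \<eta> \<xi> \<le> C \<eta>\<^sub>0"
    by metis
  let ?D = "{\<eta>. tnorm M x \<eta> \<le> \<epsilon>}"
  have "?D \<subseteq> (\<Union>\<eta>\<^sub>0\<in>?D. ball \<eta>\<^sub>0 (r \<eta>\<^sub>0))"
  proof
    fix \<eta> assume "\<eta> \<in> ?D"
    then show "\<eta> \<in> (\<Union>\<eta>\<^sub>0\<in>?D. ball \<eta>\<^sub>0 (r \<eta>\<^sub>0))" using r(1)[of \<eta>] by (intro UN_I) auto
  qed
  then obtain F where F: "F \<subseteq> ?D" "finite F" "?D \<subseteq> (\<Union>\<eta>\<^sub>0\<in>F. ball \<eta>\<^sub>0 (r \<eta>\<^sub>0))"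
    by (rule compactE_image[OF compact_tnorm_cball open_ball]) (rule that)
  have "bdd_above (C ` F)" using F(2) by simp
  then obtain B where B: "\<And>\<eta>\<^sub>0. \<eta>\<^sub>0 \<in> F \<Longrightarrow> C \<eta>\<^sub>0 \<le> B" by (auto simp: bdd_above_def)
  show thesis
  proof
    fix \<eta> \<xi> assume "tnorm M x \<eta> \<le> \<epsilon>" and \<xi>: "\<xi> \<in> subdiff M f (retr M x \<eta>)"
    then obtain \<eta>\<^sub>0 where "\<eta>\<^sub>0 \<in> F" "\<eta> \<in> ball \<eta>\<^sub>0 (r \<eta>\<^sub>0)" using F(3) by blast
    then show "?v \<eta> \<xi> \<le> B" using r(2)[OF _ \<xi>] B order.trans by blast
  qed
qed

lemma closure_ball_R_subset: "closure (ball_R M x \<epsilon>) \<subseteq> retr M x ` {\<eta>. tnorm M x \<eta> \<le> \<epsilon>}"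
proof (rule closure_minimal)
  show "ball_R M x \<epsilon> \<subseteq> retr M x ` {\<eta>. tnorm M x \<eta> \<le> \<epsilon>}"
    by (auto simp: ball_R_def tball_def)
  show "closed (retr M x ` {\<eta>. tnorm M x \<eta> \<le> \<epsilon>})"
    by (intro compact_imp_closed compact_continuous_image compact_tnorm_cball
        continuous_on_subset[OF continuous_on_retr]) simp
qed

lemma retr_inv_retr:
  assumes "ereal \<epsilon> < inj_radius_at M x" "tnorm M x \<eta> \<le> \<epsilon>"
  shows "retr_inv M x (retr M x \<eta>) = \<eta>"
  unfolding retr_inv_def
proof (rule the_equality)
  have \<eta>: "ereal (tnorm M x \<eta>) < inj_radius_at M x"
    using assms by (meson ereal_less_eq(3) order.strict_trans1)
  then show "ereal (tnorm M x \<eta>) < inj_radius_at M x \<and> retr M x \<eta> = retr M x \<eta>" by simp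
  fix \<zeta> assume \<zeta>: "ereal (tnorm M x \<zeta>) < inj_radius_at M x \<and> retr M x \<zeta> = retr M x \<eta>"
  have "ereal (max (tnorm M x \<eta>) (tnorm M x \<zeta>)) < inj_radius_at M x"
    using \<eta> \<zeta> by (simp add: max_def)
  then obtain r where "max (tnorm M x \<eta>) (tnorm M x \<zeta>) < r" "inj_on (retr M x) (tball M x r)"
    unfolding inj_radius_at_def less_Sup_iff by auto
  then show "\<zeta> = \<eta>" using \<zeta> by (auto simp: tball_def dest: inj_onD)
qed

text \<open>The bound on \<open>\<epsilon>\<close> makes \<open>retr_inv M x\<close> recover the tangent vector \<open>\<eta>\<close> from each point \<open>retr M x \<eta>\<close> of the
  closed ball, so the spanning vectors are the bounded ones considered above.\<close>

lemma compact_eps_subdiff: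
  assumes f: "locally_lipschitz M f" and \<epsilon>: "ereal \<epsilon> < inj_radius_at M x"
  shows "compact (eps_subdiff M \<epsilon> f x)"
proof -
  let ?A = "\<Union>y\<in>closure (ball_R M x \<epsilon>).
    (\<lambda>\<xi>. inverse (beta M x (retr_inv M x y)) *\<^sub>R transp_back M x y \<xi>) ` subdiff M f y"
  obtain C where C: "\<And>\<eta> \<xi>. tnorm M x \<eta> \<le> \<epsilon> \<Longrightarrow> \<xi> \<in> subdiff M f (retr M x \<eta>) \<Longrightarrow>
      tnorm M x (inverse (beta M x \<eta>) *\<^sub>R inv (transp M x \<eta>) \<xi>) \<le> C"
    by (rule pulled_back_subgradients_bounded[OF f]) (rule that)
  have "?A \<subseteq> {v. tnorm M x v \<le> C}"
  proof
    fix v assume "v \<in> ?A"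
    then obtain y \<xi> where y: "y \<in> closure (ball_R M x \<epsilon>)" "\<xi> \<in> subdiff M f y"
      and v: "v = inverse (beta M x (retr_inv M x y)) *\<^sub>R transp_back M x y \<xi>" by blast
    obtain \<eta> where \<eta>: "tnorm M x \<eta> \<le> \<epsilon>" "y = retr M x \<eta>"
      using y(1) closure_ball_R_subset[of x \<epsilon>] by blast
    then show "v \<in> {v. tnorm M x v \<le> C}"
      using C[OF \<eta>(1)] y(2) by (simp add: v transp_back_def retr_inv_retr[OF \<epsilon>])
  qed
  then have "bounded ?A"
    by (rule bounded_subset[OF compact_imp_bounded[OF compact_tnorm_cball]])
  then show ?thesis
    unfolding eps_subdiff_def compact_closure by (rule bounded_convex_hull)
qed

lemma compact_G_eps:
  assumes "\<forall>i\<in>{1..m}. locally_lipschitz M (f i)" and "ereal \<epsilon> < inj_radius_at M x"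
  shows "compact (G_eps M f m \<epsilon> x)"
  unfolding G_eps_def using assms
  by (intro compact_convex_hull compact_UN compact_eps_subdiff) auto


section \<open>The descent direction procedure\<close>

lemma ns_loop_returns:
  assumes "ns_loop M \<phi> x g c a b t \<xi>" and "a < b"
  shows "a < t \<and> t < b \<and> \<xi> \<in> subdiff M \<phi> (retr M x (t *\<^sub>R g)) \<and>
    metric M x (ns_pull M x g t \<xi>) g > - c * (tnorm M x g)\<^sup>2"
  using assms
proof (induction rule: ns_loop.induct)
  case (stop t a b \<xi>)
  then show ?case by simp
next
  case (left s a b \<zeta> t \<xi>)
  have "a < s" "s < b" using left.hyps(1) left.prems by simp_all
  then show ?case using left.IH by simp
next
  case (right s a b \<zeta> t \<xi>)
  have "a < s" "s < b" using right.hyps(1) right.prems by simp_all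
  then show ?case using right.IH by simp
qed

lemma ns_pull_in_eps_subdiff:
  assumes \<epsilon>: "ereal \<epsilon> < inj_radius_at M x" and t: "tnorm M x (t *\<^sub>R g) < \<epsilon>"
    and \<xi>: "\<xi> \<in> subdiff M \<phi> (retr M x (t *\<^sub>R g))"
  shows "ns_pull M x g t \<xi> \<in> eps_subdiff M \<epsilon> \<phi> x"
proof -
  let ?y = "retr M x (t *\<^sub>R g)"
  have "?y \<in> closure (ball_R M x \<epsilon>)"
    using t by (intro subsetD[OF closure_subset]) (auto simp: ball_R_def tball_def)
  moreover have "ns_pull M x g t \<xi> = inverse (beta M x (retr_inv M x ?y)) *\<^sub>R transp_back M x ?y \<xi>"
    using t by (simp add: ns_pull_def retr_inv_retr[OF \<epsilon>])
  ultimately have "ns_pull M x g t \<xi> \<in> (\<Union>y\<in>closure (ball_R M x \<epsilon>).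
      (\<lambda>\<xi>. inverse (beta M x (retr_inv M x y)) *\<^sub>R transp_back M x y \<xi>) ` subdiff M \<phi> y)"
    using \<xi> by blast
  then show ?thesis
    unfolding eps_subdiff_def by (rule subsetD[OF order.trans[OF hull_subset closure_subset]])
qed

lemma dd_step_new_subgradient:
  assumes "ereal \<epsilon> < inj_radius_at M x" and "0 < \<epsilon>" and "0 < \<delta>"
    and "dd_step M f m \<epsilon> \<delta> c x W W'"
  obtains g \<xi> where "dd_direction M x W g" "\<delta> < tnorm M x g"
    "W \<subseteq> W'" "W' \<subseteq> W \<union> (\<Union>i\<in>{1..m}. eps_subdiff M \<epsilon> (f i) x)"
    "\<xi> \<in> W'" "\<xi> \<in> (\<Union>i\<in>{1..m}. eps_subdiff M \<epsilon> (f i) x)"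
    "metric M x \<xi> g > - c * (tnorm M x g)\<^sup>2"
proof -
  obtain g \<Xi> where g: "dd_direction M x W g" "\<not> tnorm M x g \<le> \<delta>" "dd_bad M f m \<epsilon> c x g \<noteq> {}"
    and \<Xi>: "\<forall>j\<in>dd_bad M f m \<epsilon> c x g. \<exists>t \<xi>. ns_returns M (f j) x g \<epsilon> c t \<xi> \<and> \<Xi> j = ns_pull M x g t \<xi>"
    and W': "W' = W \<union> \<Xi> ` dd_bad M f m \<epsilon> c x g"
    using assms(4) unfolding dd_step_def by (elim exE conjE) (rule that)
  have new: "\<Xi> j \<in> (\<Union>i\<in>{1..m}. eps_subdiff M \<epsilon> (f i) x) \<and> metric M x (\<Xi> j) g > - c * (tnorm M x g)\<^sup>2"
    if j: "j \<in> dd_bad M f m \<epsilon> c x g" for j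
  proof -
    obtain t \<xi> where t: "ns_loop M (f j) x g c 0 (\<epsilon> / tnorm M x g) t \<xi>" "\<Xi> j = ns_pull M x g t \<xi>"
      using \<Xi> j unfolding ns_returns_def by blast
    have pos: "tnorm M x g > 0" using g(2) assms(3) by simp
    then have b: "0 < \<epsilon> / tnorm M x g" using assms(2) by simp
    note r = ns_loop_returns[OF t(1) b]
    then have "tnorm M x (t *\<^sub>R g) < \<epsilon>"
      using pos by (simp add: tnorm_scaleR field_simps)
    then have "\<Xi> j \<in> eps_subdiff M \<epsilon> (f j) x"
      unfolding t(2) using r by (intro ns_pull_in_eps_subdiff assms(1)) auto
    moreover have "j \<in> {1..m}" using j by (simp add: dd_bad_def)
    ultimately show ?thesis using r by (auto simp: t(2))
  qed
  obtain j where j: "j \<in> dd_bad M f m \<epsilon> c x g" using g(3) by blast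
  show thesis
  proof (rule that[of g "\<Xi> j"])
    show "W' \<subseteq> W \<union> (\<Union>i\<in>{1..m}. eps_subdiff M \<epsilon> (f i) x)" using new W' by blast
  qed (use g W' new j in auto)
qed

lemma dd_steps_in_eps_subdiffs:
  assumes \<epsilon>: "ereal \<epsilon> < inj_radius_at M x" "0 < \<epsilon>" "0 < \<delta>"
    and "(dd_step M f m \<epsilon> \<delta> c x)\<^sup>*\<^sup>* W W'" and "W \<subseteq> (\<Union>i\<in>{1..m}. eps_subdiff M \<epsilon> (f i) x)"
  shows "W' \<subseteq> (\<Union>i\<in>{1..m}. eps_subdiff M \<epsilon> (f i) x)"
  using assms(4,5)
proof (induction rule: rtranclp_induct)
  case (step W' W'')
  have "W'' \<subseteq> W' \<union> (\<Union>i\<in>{1..m}. eps_subdiff M \<epsilon> (f i) x)"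
    by (rule dd_step_new_subgradient[OF \<epsilon> step.hyps(2)])
  then show ?case using step.IH[OF step.prems] by blast
qed

lemma dd_init_in_eps_subdiffs:
  "dd_init M f m \<epsilon> x W \<Longrightarrow> W \<subseteq> (\<Union>i\<in>{1..m}. eps_subdiff M \<epsilon> (f i) x)"
  unfolding dd_init_def by blast

text \<open>The point \<open>- g\<close> of least norm in the convex hull of \<open>W\<close> satisfies \<open>\<langle>v, g\<rangle> \<le> - \<parallel>g\<parallel>\<^sup>2\<close> for all \<open>v\<close> in that hull.
  The new subgradient \<open>\<xi>\<close> violates this by more than \<open>(1 - c) \<parallel>g\<parallel>\<^sup>2\<close>, so a small step from \<open>- g\<close> towards
  \<open>\<xi>\<close> shortens the vector.\<close>

lemma dd_direction_shrinks:
  assumes c: "0 < c" "c < 1" and \<delta>: "0 < \<delta>" "\<delta> < tnorm M x g"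
    and g: "dd_direction M x W g" and g': "dd_direction M x W' g'"
    and W': "W \<subseteq> W'" "\<xi> \<in> W'" and \<xi>: "metric M x \<xi> g > - c * (tnorm M x g)\<^sup>2"
    and B: "tnorm M x g \<le> B" "tnorm M x \<xi> \<le> B"
  shows "(tnorm M x g')\<^sup>2 \<le> (tnorm M x g)\<^sup>2 - ((1 - c) * \<delta>\<^sup>2)\<^sup>2 / (2 * B\<^sup>2)"
proof -
  (* the minimizer of the quadratic bound below *)
  define s where "s = (1 - c) * \<delta>\<^sup>2 / (2 * B\<^sup>2)"
  define z where "z = (1 - s) *\<^sub>R (- g) + s *\<^sub>R \<xi>"
  let ?A = "(tnorm M x g)\<^sup>2"
  have "B > 0" using \<delta> B by simp
  have A: "\<delta>\<^sup>2 \<le> ?A" "?A \<le> B\<^sup>2" "(tnorm M x \<xi>)\<^sup>2 \<le> B\<^sup>2"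
    using \<delta> B tnorm_nonneg by (auto intro!: power_mono)
  have "(1 - c) * \<delta>\<^sup>2 \<le> 1 * \<delta>\<^sup>2"
    using c by (intro mult_right_mono) auto
  also have "\<dots> \<le> 2 * B\<^sup>2"
    using A zero_le_power2[of B] by linarith
  finally have "(1 - c) * \<delta>\<^sup>2 \<le> 2 * B\<^sup>2" .
  then have s: "0 \<le> s" "s \<le> 1"
    using c \<open>B > 0\<close> by (auto simp: s_def)
  have "- g \<in> convex hull W" using g by (auto simp: dd_direction_def is_arg_min_def)
  then have "- g \<in> convex hull W'" using hull_mono[OF W'(1)] by blast
  moreover have "\<xi> \<in> convex hull W'" using W'(2) by (rule hull_inc)
  ultimately have "z \<in> convex hull W'"
    unfolding z_def using s by (intro convexD_alt convex_convex_hull)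
  then have "- z \<in> uminus ` (convex hull W')" by blast
  then have "tnorm M x g' \<le> tnorm M x (- z)"
    using g' by (auto simp: dd_direction_def is_arg_min_def not_less)
  then have "(tnorm M x g')\<^sup>2 \<le> (tnorm M x z)\<^sup>2"
    by (simp add: tnorm_minus tnorm_nonneg power_mono)
  also have "\<dots> = (1 - s)\<^sup>2 * ?A - 2 * s * (1 - s) * metric M x \<xi> g + s\<^sup>2 * (tnorm M x \<xi>)\<^sup>2"
    unfolding tnorm_power2 z_def
    by (simp add: bilinear_ladd[OF metric_bilinear] bilinear_radd[OF metric_bilinear]
        bilinear_lmul[OF metric_bilinear] bilinear_rmul[OF metric_bilinear]
        bilinear_lneg[OF metric_bilinear] bilinear_rneg[OF metric_bilinear]
        bilinear_lsub[OF metric_bilinear] bilinear_rsub[OF metric_bilinear] metric_sym[of x g \<xi>])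
      (simp add: power2_eq_square algebra_simps)
  also have "\<dots> \<le> (1 - s)\<^sup>2 * ?A + 2 * s * (1 - s) * (c * ?A) + s\<^sup>2 * B\<^sup>2"
  proof -
    have "2 * s * (1 - s) * (- metric M x \<xi> g) \<le> 2 * s * (1 - s) * (c * ?A)"
      using s \<xi> by (intro mult_left_mono) auto
    moreover have "s\<^sup>2 * (tnorm M x \<xi>)\<^sup>2 \<le> s\<^sup>2 * B\<^sup>2"
      using A by (intro mult_left_mono) auto
    ultimately show ?thesis unfolding mult_minus_right by linarith
  qed
  also have "\<dots> = ?A - 2 * s * (1 - c) * ?A + s\<^sup>2 * (?A + B\<^sup>2) - 2 * s\<^sup>2 * c * ?A"
    by (simp add: power2_eq_square algebra_simps)
  also have "\<dots> \<le> ?A - 2 * s * (1 - c) * \<delta>\<^sup>2 + s\<^sup>2 * (B\<^sup>2 + B\<^sup>2) - 0"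
    using s c A by (intro diff_mono add_mono mult_left_mono) auto
  also have "\<dots> = ?A - ((1 - c) * \<delta>\<^sup>2)\<^sup>2 / (2 * B\<^sup>2)"
    using \<open>B > 0\<close> by (simp add: s_def power2_eq_square field_simps)
  finally show ?thesis .
qed

lemma dd_terminates:
  assumes f: "\<forall>i\<in>{1..m}. locally_lipschitz M (f i)"
    and \<epsilon>: "ereal \<epsilon> < inj_radius_at M x" "0 < \<epsilon>" and \<delta>: "0 < \<delta>" and c: "0 < c" "c < 1"
  shows "\<not> dd_diverges M f m \<epsilon> \<delta> c x"
proof
  assume "dd_diverges M f m \<epsilon> \<delta> c x"
  then obtain W where W: "dd_init M f m \<epsilon> x (W 0)"
    "\<And>s. dd_step M f m \<epsilon> \<delta> c x (W s) (W (Suc s))"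
    unfolding dd_diverges_def by blast
  let ?E = "\<Union>i\<in>{1..m}. eps_subdiff M \<epsilon> (f i) x"
  have "compact ?E" using f \<epsilon> by (intro compact_UN compact_eps_subdiff) auto
  then have "bdd_above (tnorm M x ` ?E)"
    by (intro bounded_imp_bdd_above compact_imp_bounded compact_continuous_image continuous_on_tnorm)
  then obtain B where B: "\<And>v. v \<in> ?E \<Longrightarrow> tnorm M x v \<le> B"
    by (meson bdd_above_def imageI)
  have WE: "W s \<subseteq> ?E" for s
  proof (induction s)
    case 0
    then show ?case using dd_init_in_eps_subdiffs[OF W(1)] .
  next
    case (Suc s)
    then show ?case using dd_steps_in_eps_subdiffs[OF \<epsilon> \<delta> r_into_rtranclp, of f m c "W s"] W(2) by blast
  qed
  have "\<exists>g \<xi>. dd_direction M x (W s) g \<and> \<delta> < tnorm M x g \<and> W s \<subseteq> W (Suc s) \<and>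
      \<xi> \<in> W (Suc s) \<and> metric M x \<xi> g > - c * (tnorm M x g)\<^sup>2" for s
    by (rule dd_step_new_subgradient[OF \<epsilon> \<delta> W(2)[of s]]) blast
  then obtain g \<xi> where g: "\<And>s. dd_direction M x (W s) (g s)" "\<And>s. \<delta> < tnorm M x (g s)"
    and step: "\<And>s. W s \<subseteq> W (Suc s)" "\<And>s. \<xi> s \<in> W (Suc s)"
      "\<And>s. metric M x (\<xi> s) (g s) > - c * (tnorm M x (g s))\<^sup>2"
    by metis
  have gB: "tnorm M x (g s) \<le> B" for s
  proof -
    have "W s \<noteq> {}" using g(1)[of s] by (auto simp: dd_direction_def is_arg_min_def)
    then obtain w where w: "w \<in> W s" by blast
    then have "- w \<in> uminus ` (convex hull W s)" by (simp add: hull_inc)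
    then have "tnorm M x (g s) \<le> tnorm M x (- w)"
      using g(1)[of s] by (auto simp: dd_direction_def is_arg_min_def not_less)
    also have "\<dots> \<le> B" using B[OF subsetD[OF WE w]] by (simp only: tnorm_minus)
    finally show ?thesis .
  qed
  define \<kappa> where "\<kappa> = ((1 - c) * \<delta>\<^sup>2)\<^sup>2 / (2 * B\<^sup>2)"
  have "B > 0" using gB[of 0] g(2)[of 0] \<delta> by simp
  then have "\<kappa> > 0" using c \<delta> by (simp add: \<kappa>_def)
  have shrink: "(tnorm M x (g (Suc s)))\<^sup>2 \<le> (tnorm M x (g s))\<^sup>2 - \<kappa>" for s
    unfolding \<kappa>_def
    by (rule dd_direction_shrinks[OF c \<delta> g(2) g(1) g(1) step gB]) (rule B[OF subsetD[OF WE step(2)]])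
  have bound: "(tnorm M x (g s))\<^sup>2 \<le> (tnorm M x (g 0))\<^sup>2 - real s * \<kappa>" for s
  proof (induction s)
    case (Suc s)
    then show ?case using shrink[of s] by (simp add: algebra_simps)
  qed simp
  obtain s where "real s * \<kappa> > (tnorm M x (g 0))\<^sup>2"
    using reals_Archimedean3[OF \<open>\<kappa> > 0\<close>] by blast
  then have "(tnorm M x (g s))\<^sup>2 < 0" using bound[of s] by linarith
  then show False by simp
qed

lemma alg_stops_imp_critical:
  assumes f: "\<forall>i\<in>{1..m}. locally_lipschitz M (f i)"
    and \<epsilon>: "ereal \<epsilon> < inj_radius_at M x" "0 < \<epsilon>" and \<delta>: "0 < \<delta>"
    and "alg_stops M f m \<epsilon> \<delta> c x"
  shows "eps_delta_critical M f m \<epsilon> \<delta> x"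
proof -
  let ?G = "uminus ` G_eps M f m \<epsilon> x"
  obtain g W\<^sub>0 W where g: "dd_direction M x W g" "tnorm M x g \<le> \<delta>"
    and W: "dd_init M f m \<epsilon> x W\<^sub>0" "(dd_step M f m \<epsilon> \<delta> c x)\<^sup>*\<^sup>* W\<^sub>0 W"
    using assms(5) unfolding alg_stops_def dd_returns_def by blast
  have "W \<subseteq> (\<Union>i\<in>{1..m}. eps_subdiff M \<epsilon> (f i) x)"
    by (rule dd_steps_in_eps_subdiffs[OF \<epsilon> \<delta> W(2) dd_init_in_eps_subdiffs[OF W(1)]])
  then have "convex hull W \<subseteq> G_eps M f m \<epsilon> x"
    unfolding G_eps_def by (rule hull_mono)
  then have gG: "g \<in> ?G"
    using g(1) by (auto simp: dd_direction_def is_arg_min_def)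
  have "compact ?G"
    by (intro compact_continuous_image compact_G_eps f \<epsilon> continuous_intros)
  then obtain g' where g': "g' \<in> ?G" "\<And>v. v \<in> ?G \<Longrightarrow> tnorm M x g' \<le> tnorm M x v"
    using continuous_attains_inf[OF _ _ continuous_on_tnorm, of ?G] gG by blast
  then have "is_arg_min (tnorm M x) (\<lambda>g. g \<in> ?G) g'"
    unfolding is_arg_min_def using leD by blast
  moreover have "tnorm M x g' \<le> \<delta>"
    using g'(2)[OF gG] g(2) by (rule order.trans)
  ultimately show ?thesis unfolding eps_delta_critical_def by blast
qed

end


section \<open>The descent method\<close>

lemma armijo_step_length:
  assumes "armijo M f m \<epsilon> c \<alpha> t\<^sub>0 x g l" and "0 < \<epsilon>" "1 < \<alpha>" "0 < t\<^sub>0" "0 < tnorm M x g"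
  shows "\<epsilon> \<le> t\<^sub>0 / \<alpha> ^ l * tnorm M x g"
proof -
  have "int l \<le> \<lfloor>(ln (t\<^sub>0 * tnorm M x g) - ln \<epsilon>) / ln \<alpha>\<rfloor>"
    using assms(1) by (simp add: armijo_def)
  then have "real l \<le> (ln (t\<^sub>0 * tnorm M x g) - ln \<epsilon>) / ln \<alpha>"
    by (simp add: le_floor_iff)
  then have "ln (\<alpha> ^ l) + ln \<epsilon> \<le> ln (t\<^sub>0 * tnorm M x g)"
    using assms by (simp add: ln_realpow pos_le_divide_eq)
  then have "ln (\<alpha> ^ l * \<epsilon>) \<le> ln (t\<^sub>0 * tnorm M x g)"
    using assms by (simp add: ln_mult)
  then have "\<alpha> ^ l * \<epsilon> \<le> t\<^sub>0 * tnorm M x g"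
    using assms by (subst (asm) ln_le_cancel_iff) auto
  then show ?thesis using assms by (simp add: field_simps)
qed

text \<open>The bound on the backtracking exponent keeps the step at least \<open>\<epsilon>\<close> long, and the fallback
  step has length exactly \<open>\<epsilon>\<close>. Its decrease is guaranteed because a direction longer than \<open>\<delta>\<close>
  is only returned when no objective is bad.\<close>

lemma alg_step_decrease:
  assumes "alg_step M f m \<epsilon> \<delta> c \<alpha> t\<^sub>0 x x'" and pos: "0 < \<epsilon>" "0 < \<delta>" "0 < c" "1 < \<alpha>" "0 < t\<^sub>0"
    and i: "i \<in> {1..m}"
  shows "f i x' \<le> f i x - c * \<epsilon> * \<delta>"
proof -
  let ?t = "step_size M f m \<epsilon> c \<alpha> t\<^sub>0 x"
  obtain g where g: "dd_returns M f m \<epsilon> \<delta> c x g" "\<not> tnorm M x g \<le> \<delta>" and x': "x' = retr M x (?t g *\<^sub>R g)"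
    using assms(1) unfolding alg_step_def by blast
  then have n: "tnorm M x g > 0" and bad: "dd_bad M f m \<epsilon> c x g = {}"
    using pos by (auto simp: dd_returns_def)
  have "f i x' \<le> f i x - ?t g * c * (tnorm M x g)\<^sup>2 \<and> \<epsilon> \<le> ?t g * tnorm M x g"
  proof (cases "\<exists>l. armijo M f m \<epsilon> c \<alpha> t\<^sub>0 x g l")
    case True
    define l where "l = (LEAST l. armijo M f m \<epsilon> c \<alpha> t\<^sub>0 x g l)"
    have l: "armijo M f m \<epsilon> c \<alpha> t\<^sub>0 x g l" unfolding l_def using True by (rule LeastI_ex)
    have t: "?t g = t\<^sub>0 / \<alpha> ^ l" using True by (simp add: step_size_def l_def)
    show ?thesis
      using l armijo_step_length[OF l pos(1,4,5) n] i unfolding x' t by (simp add: armijo_def)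
  next
    case False
    then have t: "?t g = \<epsilon> / tnorm M x g" by (simp add: step_size_def)
    have "f i x' \<le> f i x - c * \<epsilon> * tnorm M x g"
      using bad i unfolding x' t by (auto simp: dd_bad_def not_less)
    then show ?thesis using n by (simp add: t power2_eq_square mult.commute)
  qed
  moreover have "\<epsilon> * \<delta> \<le> (?t g * tnorm M x g) * tnorm M x g"
    using calculation g(2) pos by (intro mult_mono) auto
  then have "c * (\<epsilon> * \<delta>) \<le> c * ((?t g * tnorm M x g) * tnorm M x g)"
    using pos by (intro mult_left_mono) auto
  ultimately show ?thesis by (simp add: power2_eq_square mult.assoc mult.left_commute)
qed

theorem theorem4p4:
  fixes M :: "('a::{t2_space,second_countable_topology}, 'e::euclidean_space) rmanifold"
    and f :: "nat \<Rightarrow> 'a \<Rightarrow> real" and m :: nat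
    and \<epsilon> \<delta> c \<alpha> t\<^sub>0 :: real
    and x\<^sub>0 :: 'a and X :: "nat \<Rightarrow> 'a" and N :: enat
  assumes "transport_manifold M"
    and "\<forall>i\<in>{1..m}. locally_lipschitz M (f i)"
    and "\<exists>i\<in>{1..m}. bdd_below (range (f i))"
    and "0 < \<epsilon>" and "ereal \<epsilon> < inj_radius M / 2"
    and "0 < \<delta>" and "0 < c" and "c < 1" and "1 < \<alpha>" and "0 < t\<^sub>0"
    and "generated_sequence M f m \<epsilon> \<delta> c \<alpha> t\<^sub>0 x\<^sub>0 X N"
  shows "\<exists>n. N = enat n \<and> eps_delta_critical M f m \<epsilon> \<delta> (X n)"
proof -
  interpret transport_manifold M by (rule assms(1))
  have inj: "ereal \<epsilon> < inj_radius_at M x" for x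
  proof -
    have "ereal \<epsilon> < inj_radius M"
      using assms(4,5) by (cases "inj_radius M") auto
    also have "\<dots> \<le> inj_radius_at M x" unfolding inj_radius_def by (rule INF_lower) simp
    finally show ?thesis .
  qed
  have "N \<noteq> \<infinity>"
  proof
    assume "N = \<infinity>"
    obtain i where i: "i \<in> {1..m}" and "bdd_below (range (f i))"
      using assms(3) by blast
    then obtain b where b: "\<And>x. b \<le> f i x"
      by (auto simp: bdd_below_def)
    have step: "f i (X (Suc k)) \<le> f i (X k) - c * \<epsilon> * \<delta>" for k
      using assms \<open>N = \<infinity>\<close> i by (intro alg_step_decrease[where \<alpha> = \<alpha> and t\<^sub>0 = t\<^sub>0 and m = m])
        (auto simp: generated_sequence_def)
    have bound: "f i (X k) \<le> f i (X 0) - real k * (c * \<epsilon> * \<delta>)" for k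
    proof (induction k)
      case (Suc k)
      then show ?case using step[of k] by (simp add: algebra_simps)
    qed simp
    have "c * \<epsilon> * \<delta> > 0" using assms by simp
    then obtain k where "real k * (c * \<epsilon> * \<delta>) > f i (X 0) - b"
      using reals_Archimedean3 by blast
    then show False using b[of "X k"] bound[of k] by linarith
  qed
  then obtain n where N: "N = enat n" by blast
  then have "alg_stops M f m \<epsilon> \<delta> c (X n)"
    using assms(11) dd_terminates[OF assms(2) inj assms(4,6,7,8)] by (auto simp: generated_sequence_def)
  then have "eps_delta_critical M f m \<epsilon> \<delta> (X n)"
    by (rule alg_stops_imp_critical[OF assms(2) inj assms(4,6)])
  then show ?thesis using N by blast
qed

end
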